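(* Let $C_a \subset \mathbb{P}^2$ be the plane quartic over $\mathbb{C}$ defined by $X^4 - X^3Y + Y^3Z = 0$, with its smooth Galois points $P_1 = (1:1:0)$ and $P_2 = (8:-16:3)$. Let $C_b \subset \mathbb{P}^2$ be the plane quartic over $\mathbb{C}$ defined by $X^4 - Y^3Z = 0$, with its smooth Galois point $P_3 = (0:1:0)$. For $i=1,2$ let $\sigma_i$ be a generator of the Galois group $G_{P_i}$ of $C_a$ at $P_i$, regarded as a birational transformation of $C_a$, and let $\sigma_3$ be a generator of the Galois group $G_{P_3}$ of $C_b$ at $P_3$, regarded as a birational transformation of $C_b$. Then each of $\sigma_1$, $\sigma_2$, $\sigma_3$ is the restriction of a Cremona transformation. Furthermore, $\sigma_1$ and $\sigma_2$ are conjugate to linear transformations, that is, for $i = 1,2$ there is a Cremona transformation $\widetilde{\sigma}_i \in \mathrm{Bir}(\mathbb{P}^2)$ with $\widetilde{\sigma}_i|_{C_a} = \sigma_i$ such that $\widetilde{\sigma}_i$ is conjugate in $\mathrm{Bir}(\mathbb{P}^2)$ to an element of $\mathrm{PGL}(3,\mathbb{C})$. In addition, $\sigma_3$ is a linear transformation, that is, there is $\widetilde{\sigma}_3 \in \mathrm{PGL}(3,\mathbb{C})$ with $\widetilde{\sigma}_3|_{C_b} = \sigma_3$.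
   Context: The ground field is $k = \mathbb{C}$, and $(X:Y:Z)$ are homogeneous coordinates on $\mathbb{P}^2$. Galois points. Let $C \subset \mathbb{P}^2$ be an irreducible plane curve of degree $d \geq 3$ with function field $k(C)$. For a point $P \in \mathbb{P}^2$, let $\pi_P : C \dashrightarrow \mathbb{P}^1$ be the restriction to $C$ of the projection $\mathbb{P}^2 \dashrightarrow \mathbb{P}^1$ with center $P$, and let $K_P = \pi_P^*(k(\mathbb{P}^1)) \subset k(C)$. The point $P$ is a Galois point for $C$ if the field extension $k(C)/K_P$ is Galois; then $G_P = \mathrm{Gal}(k(C)/K_P)$ is called the Galois group at $P$. A Galois point $P$ is called smooth if $P$ is a non-singular point of $C$. Each element $\sigma \in G_P$ induces a birational transformation $C \dashrightarrow C$ over $\mathbb{P}^1$ (i.e. compatible with $\pi_P$), denoted by the same letter $\sigma$. The points $P_1, P_2$ are smooth Galois points for $C_a$, the point $P_3$ is a smooth Galois point for $C_b$, and each $G_{P_i}$ $(i=1,2,3)$ is cyclic of order three. Cremona transformations. $\mathrm{Bir}(\mathbb{P}^2)$ is the group of birational transformations of $\mathbb{P}^2$ over $\mathbb{C}$; its elements are called Cremona transformations. Linear transformations are the elements of the subgroup $\mathrm{PGL}(3,\mathbb{C}) \subset \mathrm{Bir}(\mathbb{P}^2)$. For an irreducible curve $C\subset\mathbb{P}^2$ and a birational transformation $\sigma: C \dashrightarrow C$, writing $\widetilde{\sigma}|_C = \sigma$ for $\widetilde{\sigma} \in \mathrm{Bir}(\mathbb{P}^2)$ means that $\widetilde{\sigma}$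 is defined at the general point of $C$ and its restriction to $C$ equals $\sigma$ as a rational map. *)

theory Defs
  imports "HOL-Analysis.Analysis" "HOL-Algebra.Algebra"
begin

text \<open>
  Projective geometry over the complex numbers in homogeneous coordinates. Points of the
  projective space of dimension \<open>CARD('n) - 1\<close> are represented by nonzero vectors of type
  \<open>complex ^ 'n\<close>, and a projective variety by the cone of all nonzero vectors representing
  its points. Homogeneous polynomials are identified with the polynomial functions they induce,
  which is harmless because the field is infinite. Definitions with an argument \<open>V\<close> are meant
  for cones over irreducible varieties.
\<close>

text \<open>The zero function is a form of every degree.\<close>

definition form :: "nat \<Rightarrow> (complex ^ 'n \<Rightarrow> complex) \<Rightarrow> bool" where
  "form d F \<longleftrightarrow> (\<exists>c :: ('n \<Rightarrow> nat) \<Rightarrow> complex. \<forall>v.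
     F v = (\<Sum>\<alpha> | sum \<alpha> UNIV = d. c \<alpha> * (\<Prod>i\<in>UNIV. (v $ i) ^ \<alpha> i)))"

definition proj_space :: "(complex ^ 'n) set" where
  "proj_space = {v. v \<noteq> 0}"

abbreviation P1 :: "(complex ^ 2) set" where "P1 \<equiv> proj_space"
abbreviation P2 :: "(complex ^ 3) set" where "P2 \<equiv> proj_space"

definition curve :: "(complex ^ 3 \<Rightarrow> complex) \<Rightarrow> (complex ^ 3) set" where
  "curve F = {v \<in> P2. F v = 0}"


section \<open>Function fields\<close>

text \<open>
  The function field of \<open>V\<close> is the degree-zero part of the homogeneous coordinate ring of
  \<open>V\<close> localized at its nonzero homogeneous elements: classes of fractions \<open>A/B\<close> of forms
  of the same degree with \<open>B\<close> not identically zero on \<open>V\<close>.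
\<close>

definition fractions ::
    "(complex ^ 'n) set \<Rightarrow> ((complex ^ 'n \<Rightarrow> complex) \<times> (complex ^ 'n \<Rightarrow> complex)) set" where
  "fractions V = {(A, B). \<exists>d. form d A \<and> form d B \<and> (\<exists>v\<in>V. B v \<noteq> 0)}"

definition frac_rel ::
    "(complex ^ 'n) set \<Rightarrow> ((complex ^ 'n \<Rightarrow> complex) \<times> (complex ^ 'n \<Rightarrow> complex)) rel" where
  "frac_rel V = {((A, B), (A', B')). (A, B) \<in> fractions V \<and> (A', B') \<in> fractions V \<and>
     (\<forall>v\<in>V. A v * B' v = A' v * B v)}"

type_synonym 'n ratfun = "((complex ^ 'n \<Rightarrow> complex) \<times> (complex ^ 'n \<Rightarrow> complex)) set"

definition function_field :: "(complex ^ 'n) set \<Rightarrow> 'n ratfun ring" where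
  "function_field V =
    \<lparr>carrier = fractions V // frac_rel V,
     mult = (\<lambda>a b. \<Union>(A, B)\<in>a. \<Union>(A', B')\<in>b.
       frac_rel V `` {(\<lambda>v. A v * A' v, \<lambda>v. B v * B' v)}),
     one = frac_rel V `` {(\<lambda>v. 1, \<lambda>v. 1)},
     ring.zero = frac_rel V `` {(\<lambda>v. 0, \<lambda>v. 1)},
     ring.add = (\<lambda>a b. \<Union>(A, B)\<in>a. \<Union>(A', B')\<in>b.
       frac_rel V `` {(\<lambda>v. A v * B' v + A' v * B v, \<lambda>v. B v * B' v)})\<rparr>"


section \<open>Rational maps and groups of birational transformations\<close>

text \<open>
  A rational map from \<open>V\<close> to \<open>W\<close> is represented by a tuple of forms of one common
  degree that do not all vanish identically on \<open>V\<close>; two such tuples represent the same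
  rational map on \<open>V\<close> iff they are proportional at every point of \<open>V\<close>.
\<close>

definition rational_map ::
    "(complex ^ 'n) set \<Rightarrow> (complex ^ 'm) set \<Rightarrow> (complex ^ 'n \<Rightarrow> complex ^ 'm) \<Rightarrow> bool" where
  "rational_map V W \<Phi> \<longleftrightarrow> (\<exists>d. \<forall>i. form d (\<lambda>v. \<Phi> v $ i)) \<and>
     (\<exists>v\<in>V. \<Phi> v \<noteq> 0) \<and> (\<forall>v\<in>V. \<Phi> v \<noteq> 0 \<longrightarrow> \<Phi> v \<in> W)"

definition same_map ::
    "(complex ^ 'n) set \<Rightarrow> (complex ^ 'n \<Rightarrow> complex ^ 'm) \<Rightarrow> (complex ^ 'n \<Rightarrow> complex ^ 'm) \<Rightarrow> bool"
  where
  "same_map V \<Phi> \<Psi> \<longleftrightarrow> (\<forall>v\<in>V. \<forall>i j. \<Phi> v $ i * \<Psi> v $ j = \<Phi> v $ j * \<Psi> v $ i)"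

text \<open>
  That the composites are rational maps again is required explicitly, since a composite of
  tuples of forms may vanish identically.
\<close>

definition birational :: "(complex ^ 'n) set \<Rightarrow> (complex ^ 'n \<Rightarrow> complex ^ 'n) \<Rightarrow> bool" where
  "birational V \<Phi> \<longleftrightarrow> rational_map V V \<Phi> \<and>
     (\<exists>\<Psi>. rational_map V V \<Psi> \<and>
        rational_map V V (\<Psi> \<circ> \<Phi>) \<and> same_map V (\<Psi> \<circ> \<Phi>) id \<and>
        rational_map V V (\<Phi> \<circ> \<Psi>) \<and> same_map V (\<Phi> \<circ> \<Psi>) id)"

definition bir_rel ::
    "(complex ^ 'n) set \<Rightarrow> (complex ^ 'n \<Rightarrow> complex ^ 'n) rel" where
  "bir_rel V = {(\<Phi>, \<Psi>). birational V \<Phi> \<and> birational V \<Psi> \<and> same_map V \<Phi> \<Psi>}"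

definition Bir :: "(complex ^ 'n) set \<Rightarrow> (complex ^ 'n \<Rightarrow> complex ^ 'n) set monoid" where
  "Bir V =
    \<lparr>carrier = Collect (birational V) // bir_rel V,
     mult = (\<lambda>f g. \<Union>\<Phi>\<in>f. \<Union>\<Psi>\<in>g. bir_rel V `` {\<Phi> \<circ> \<Psi>}),
     one = bir_rel V `` {id}\<rparr>"

definition PGL3 :: "(complex ^ 3 \<Rightarrow> complex ^ 3) set set" where
  "PGL3 = {bir_rel P2 `` {\<lambda>v. M *v v} | M :: complex ^ 3 ^ 3. invertible M}"

definition conjugate_to_linear :: "(complex ^ 3 \<Rightarrow> complex ^ 3) set \<Rightarrow> bool" where
  "conjugate_to_linear \<tau> \<longleftrightarrow> (\<exists>\<phi>\<in>carrier (Bir P2).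
     \<phi> \<otimes>\<^bsub>Bir P2\<^esub> \<tau> \<otimes>\<^bsub>Bir P2\<^esub> inv\<^bsub>Bir P2\<^esub> \<phi> \<in> PGL3)"

text \<open>
  Pullback of rational functions along (a representative of) a dominant rational map on
  \<open>V\<close>. Fractions whose denominator pulls back to zero on \<open>V\<close> contribute nothing to the union.
\<close>

definition pullback ::
    "(complex ^ 'n) set \<Rightarrow> (complex ^ 'n \<Rightarrow> complex ^ 'm) \<Rightarrow> 'm ratfun \<Rightarrow> 'n ratfun" where
  "pullback V \<Phi> a = (\<Union>(A, B)\<in>a. frac_rel V `` {(A \<circ> \<Phi>, B \<circ> \<Phi>)})"

text \<open>
  The birational transformation of \<open>V\<close>, as an element of \<open>Bir V\<close>, that induces a given
  automorphism of the function field of \<open>V\<close>.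
\<close>

definition birational_of :: "(complex ^ 'n) set \<Rightarrow> ('n ratfun \<Rightarrow> 'n ratfun) \<Rightarrow>
    (complex ^ 'n \<Rightarrow> complex ^ 'n) set" where
  "birational_of V \<sigma> =
     {\<Phi>. birational V \<Phi> \<and> (\<forall>a\<in>carrier (function_field V). pullback V \<Phi> a = \<sigma> a)}"

text \<open>
  For an element \<open>\<tau>\<close> of \<open>Bir P2\<close> and \<open>s\<close> of \<open>Bir C\<close>: some representative of
  \<open>\<tau>\<close> also represents \<open>s\<close>. In particular it does not vanish identically on \<open>C\<close>, so \<open>\<tau>\<close>
  is defined at the general point of \<open>C\<close>.
\<close>

definition restricts_to :: "(complex ^ 3 \<Rightarrow> complex ^ 3) set \<Rightarrow> (complex ^ 3) set \<Rightarrow>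
    (complex ^ 3 \<Rightarrow> complex ^ 3) set \<Rightarrow> bool" where
  "restricts_to \<tau> C s \<longleftrightarrow> (\<exists>\<Phi>\<in>\<tau>. (\<exists>v\<in>C. \<Phi> v \<noteq> 0) \<and> \<Phi> \<in> s)"


section \<open>Galois points\<close>

definition galois_group :: "('a, 'b) ring_scheme \<Rightarrow> 'a set \<Rightarrow> ('a \<Rightarrow> 'a) monoid" where
  "galois_group L K = BijGroup (carrier L)
     \<lparr>carrier := {\<sigma> \<in> ring_hom L L \<inter> Bij (carrier L). \<forall>x\<in>K. \<sigma> x = x}\<rparr>"

definition galois_extension :: "('a, 'b) ring_scheme \<Rightarrow> 'a set \<Rightarrow> bool" where
  "galois_extension L K \<longleftrightarrow> field L \<and> subfield K L \<and>
     ring.finite_dimension L K (carrier L) \<and>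
     {x \<in> carrier L. \<forall>\<sigma>\<in>carrier (galois_group L K). \<sigma> x = x} = K"

definition projection_from :: "complex ^ 3 \<Rightarrow> (complex ^ 3 \<Rightarrow> complex ^ 2) \<Rightarrow> bool" where
  "projection_from P \<pi> \<longleftrightarrow> (\<exists>M :: complex ^ 3 ^ 2.
     \<pi> = (\<lambda>v. M *v v) \<and> {v. M *v v = 0} = range (\<lambda>c. c *s P))"

text \<open>
  All projections with center \<open>P\<close> differ by coordinate changes of the projective line, so
  they give the same subfield.
\<close>

definition K_at :: "(complex ^ 3) set \<Rightarrow> complex ^ 3 \<Rightarrow> 3 ratfun set" where
  "K_at C P = {pullback C \<pi> a | \<pi> a. projection_from P \<pi> \<and> a \<in> carrier (function_field P1)}"

definition galois_point :: "(complex ^ 3) set \<Rightarrow> complex ^ 3 \<Rightarrow> bool" where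
  "galois_point C P \<longleftrightarrow> P \<in> P2 \<and> galois_extension (function_field C) (K_at C P)"

definition G_at :: "(complex ^ 3) set \<Rightarrow> complex ^ 3 \<Rightarrow> (3 ratfun \<Rightarrow> 3 ratfun) monoid" where
  "G_at C P = galois_group (function_field C) (K_at C P)"

definition nonsingular_point :: "(complex ^ 3 \<Rightarrow> complex) \<Rightarrow> complex ^ 3 \<Rightarrow> bool" where
  "nonsingular_point F P \<longleftrightarrow> P \<in> curve F \<and> (\<exists>i. deriv (\<lambda>t. F (P + t *s axis i 1)) 0 \<noteq> 0)"

definition smooth_galois_point :: "(complex ^ 3 \<Rightarrow> complex) \<Rightarrow> complex ^ 3 \<Rightarrow> bool" where
  "smooth_galois_point F P \<longleftrightarrow> galois_point (curve F) P \<and> nonsingular_point F P"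

definition generator :: "('a, 'b) monoid_scheme \<Rightarrow> 'a \<Rightarrow> bool" where
  "generator G g \<longleftrightarrow> g \<in> carrier G \<and> generate G {g} = carrier G"


section \<open>The two quartics\<close>

definition F_a :: "complex ^ 3 \<Rightarrow> complex" where
  "F_a v = (v $ 1) ^ 4 - (v $ 1) ^ 3 * v $ 2 + (v $ 2) ^ 3 * v $ 3"

definition F_b :: "complex ^ 3 \<Rightarrow> complex" where
  "F_b v = (v $ 1) ^ 4 - (v $ 2) ^ 3 * v $ 3"

abbreviation C_a :: "(complex ^ 3) set" where "C_a \<equiv> curve F_a"
abbreviation C_b :: "(complex ^ 3) set" where "C_b \<equiv> curve F_b"

end

theory Submission
  imports Defs
begin

text \<open>
  Both quartics have the form \<open>Y\<^sup>3 Z = a X\<^sup>4 + b X\<^sup>3 Y\<close> with \<open>a \<noteq> 0\<close>: in the chart \<open>Y = 1\<close> they are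
  graphs \<open>z = a x\<^sup>4 + b x\<^sup>3\<close>. The polynomial automorphism \<open>(x, z) \<mapsto> (x, z + a x\<^sup>4 + b x\<^sup>3)\<close>
  (\<open>shear\<close>) is a Cremona transformation taking the line \<open>z = 0\<close> to the curve. So every affine
  transformation \<open>u \<mapsto> c u + e\<close> of the coordinate \<open>u = X/Y\<close> of the curve extends to the plane: extend
  it linearly from the line \<open>z = 0\<close> by \<open>(x, z) \<mapsto> (c x + e, z)\<close> and conjugate with the shear. The
  extension is conjugate to a linear map by construction.

  It remains to see that the Galois groups act on \<open>u\<close> by affine maps. For suitable \<open>e\<close>, namely
  \<open>0\<close>, \<open>1/2\<close>, \<open>0\<close> for the three points, the subfield at the point contains \<open>(u - e)\<^sup>3\<close>. An
  automorphism \<open>\<sigma>\<close> over the subfield therefore maps \<open>u - e\<close> to \<open>c (u - e)\<close> with \<open>c\<^sup>3 = 1\<close>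
  (\<open>galois_image\<close>). As the function field is generated by the constants and \<open>u\<close>, this
  determines \<open>\<sigma>\<close> (\<open>ring_homs_eqI\<close>), and \<open>\<sigma>\<close> is induced by the extension just described
  (\<open>galois_extends\<close>). On the second quartic, where \<open>z = x\<^sup>4\<close>, the linear map
  \<open>(x, z) \<mapsto> (c x, c z)\<close> also preserves the curve, because \<open>c\<^sup>4 = c\<close>, and it induces the same
  \<open>\<sigma>\<close> (\<open>galois_linear\<close>).

  Function fields and groups of birational transformations are made of classes of forms. They
  are handled in the locale \<open>irreducible_cone\<close>: irreducibility lets an identity between forms be
  checked where a given nonzero form does not vanish. The cones at hand are irreducible because
  any two of their points are joined by a rational curve (\<open>irreducible_coneI\<close>).
\<close>

section \<open>Forms\<close>

lemma finite_exponents: "finite {\<alpha> :: 'n::finite \<Rightarrow> nat. sum \<alpha> UNIV = d}"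
proof (rule finite_subset)
  show "{\<alpha> :: 'n \<Rightarrow> nat. sum \<alpha> UNIV = d} \<subseteq> (\<Pi>\<^sub>E i\<in>UNIV. {..d})"
    by (auto intro: member_le_sum)
  show "finite (\<Pi>\<^sub>E i\<in>(UNIV :: 'n set). {..d})"
    by (rule finite_PiE) auto
qed

lemma form_zero: "form d (\<lambda>v :: complex ^ 'n. 0)"
  unfolding form_def by (intro exI[of _ "\<lambda>_. 0"]) simp

lemma form_monomial:
  "form (sum \<alpha> UNIV) (\<lambda>v :: complex ^ 'n. c * (\<Prod>i\<in>UNIV. (v $ i) ^ \<alpha> i))"
  unfolding form_def
proof (intro exI allI)
  fix v :: "complex ^ 'n"
  have "(\<Sum>\<beta> | sum \<beta> UNIV = sum \<alpha> UNIV. (if \<beta> = \<alpha> then c else 0) * (\<Prod>i\<in>UNIV. (v $ i) ^ \<beta> i))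
      = (\<Sum>\<beta>\<in>{\<alpha>}. (if \<beta> = \<alpha> then c else 0) * (\<Prod>i\<in>UNIV. (v $ i) ^ \<beta> i))"
    by (rule sum.mono_neutral_right) (auto simp: finite_exponents)
  then show "c * (\<Prod>i\<in>UNIV. (v $ i) ^ \<alpha> i)
      = (\<Sum>\<beta> | sum \<beta> UNIV = sum \<alpha> UNIV. (if \<beta> = \<alpha> then c else 0) * (\<Prod>i\<in>UNIV. (v $ i) ^ \<beta> i))"
    by simp
qed

lemma form_add:
  assumes "form d F" "form d G"
  shows "form d (\<lambda>v. F v + G v)"
proof -
  obtain a where "\<And>v. F v = (\<Sum>\<alpha> | sum \<alpha> UNIV = d. a \<alpha> * (\<Prod>i\<in>UNIV. (v $ i) ^ \<alpha> i))"
    using assms(1) unfolding form_def by blast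
  moreover obtain b where "\<And>v. G v = (\<Sum>\<alpha> | sum \<alpha> UNIV = d. b \<alpha> * (\<Prod>i\<in>UNIV. (v $ i) ^ \<alpha> i))"
    using assms(2) unfolding form_def by blast
  ultimately show ?thesis
    unfolding form_def by (intro exI[of _ "\<lambda>\<alpha>. a \<alpha> + b \<alpha>"]) (simp add: distrib_right sum.distrib)
qed

lemma form_sum: "(\<And>x. x \<in> S \<Longrightarrow> form d (F x)) \<Longrightarrow> form d (\<lambda>v. \<Sum>x\<in>S. F x v)"
  by (induction S rule: infinite_finite_induct) (auto simp: form_zero form_add)

lemma form_mult:
  fixes F G :: "complex ^ 'n \<Rightarrow> complex"
  assumes "form d F" "form e G"
  shows "form (d + e) (\<lambda>v. F v * G v)"
proof -
  obtain a where a: "\<And>v. F v = (\<Sum>\<alpha> | sum \<alpha> UNIV = d. a \<alpha> * (\<Prod>i\<in>UNIV. (v $ i) ^ \<alpha> i))"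
    using assms(1) unfolding form_def by blast
  obtain b where b: "\<And>v. G v = (\<Sum>\<alpha> | sum \<alpha> UNIV = e. b \<alpha> * (\<Prod>i\<in>UNIV. (v $ i) ^ \<alpha> i))"
    using assms(2) unfolding form_def by blast
  have "(\<lambda>v. F v * G v) = (\<lambda>v. \<Sum>\<alpha> | sum \<alpha> UNIV = d. \<Sum>\<beta> | sum \<beta> UNIV = e.
      (a \<alpha> * b \<beta>) * (\<Prod>i\<in>UNIV. (v $ i) ^ (\<alpha> i + \<beta> i)))"
    by (simp add: a b sum_product power_add prod.distrib mult_ac)
  moreover have "form (d + e) (\<lambda>v :: complex ^ 'n. c * (\<Prod>i\<in>UNIV. (v $ i) ^ (\<alpha> i + \<beta> i)))"
    if "sum \<alpha> UNIV = d" "sum \<beta> UNIV = e" for \<alpha> \<beta> c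
    using form_monomial[of "\<lambda>i. \<alpha> i + \<beta> i" c] that by (simp add: sum.distrib)
  ultimately show ?thesis
    by (auto intro!: form_sum)
qed

lemma form_const: "form 0 (\<lambda>v :: complex ^ 'n. c)"
  using form_monomial[of "\<lambda>_. 0" c] by simp

lemma form_coord: "form 1 (\<lambda>v :: complex ^ 'n. v $ k)"
proof -
  have "(\<Prod>i\<in>UNIV. (v $ i) ^ (if i = k then 1 else 0)) = v $ k" for v :: "complex ^ 'n"
    using prod.delta[of UNIV k "\<lambda>i. v $ i"] by (simp add: if_distrib[of "power _"] cong: if_cong)
  then show ?thesis
    using form_monomial[of "\<lambda>i. if i = k then 1 else 0" 1] by simp
qed

lemma form_scale: "form d F \<Longrightarrow> form d (\<lambda>v. c * F v)"
  using form_mult[OF form_const] by fastforce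

lemma form_uminus: "form d F \<Longrightarrow> form d (\<lambda>v. - F v)"
  using form_scale[of d F "-1"] by simp

lemma form_diff: "form d F \<Longrightarrow> form d G \<Longrightarrow> form d (\<lambda>v. F v - G v)"
  using form_add[OF _ form_uminus] by fastforce

lemma form_power: "form d F \<Longrightarrow> form (d * n) (\<lambda>v. F v ^ n)"
proof (induction n)
  case (Suc n)
  then show ?case using form_mult[of d F "d * n" "\<lambda>v. F v ^ n"] by (simp add: algebra_simps)
qed (simp add: form_const)

lemma form_coord_power: "form n (\<lambda>v. (v $ k) ^ n)"
  using form_power[OF form_coord, of n] by simp

lemma form_prod: "finite S \<Longrightarrow> (\<And>x. x \<in> S \<Longrightarrow> form (d x) (F x)) \<Longrightarrow> form (sum d S) (\<lambda>v. \<Prod>x\<in>S. F x v)"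
  by (induction S rule: finite_induct) (auto simp: form_const intro!: form_mult)

lemma form_comp:
  fixes \<Phi> :: "complex ^ 'm \<Rightarrow> complex ^ 'n"
  assumes "form d F" and "\<And>i. form e (\<lambda>v. \<Phi> v $ i)"
  shows "form (d * e) (F \<circ> \<Phi>)"
proof -
  obtain a where a: "\<And>v. F v = (\<Sum>\<alpha> | sum \<alpha> UNIV = d. a \<alpha> * (\<Prod>i\<in>UNIV. (v $ i) ^ \<alpha> i))"
    using assms(1) unfolding form_def by blast
  have "form (d * e) (\<lambda>v. c * (\<Prod>i\<in>UNIV. (\<Phi> v $ i) ^ \<alpha> i))" if "sum \<alpha> UNIV = d" for c and \<alpha> :: "'n \<Rightarrow> nat"
  proof -
    have "form (\<Sum>i\<in>UNIV. e * \<alpha> i) (\<lambda>v. \<Prod>i\<in>UNIV. (\<Phi> v $ i) ^ \<alpha> i)"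
      by (intro form_prod form_power assms) auto
    then show ?thesis
      using that by (auto intro!: form_scale simp: sum_distrib_left[symmetric] mult.commute)
  qed
  then have "form (d * e) (\<lambda>v. \<Sum>\<alpha> | sum \<alpha> UNIV = d. a \<alpha> * (\<Prod>i\<in>UNIV. (\<Phi> v $ i) ^ \<alpha> i))"
    by (auto intro!: form_sum)
  then show ?thesis by (simp add: a comp_def)
qed

lemma form_homogeneous:
  assumes "form d F"
  shows "F (c *s v) = c ^ d * F v"
proof -
  obtain a where a: "\<And>v. F v = (\<Sum>\<alpha> | sum \<alpha> UNIV = d. a \<alpha> * (\<Prod>i\<in>UNIV. (v $ i) ^ \<alpha> i))"
    using assms(1) unfolding form_def by blast
  show ?thesis
    unfolding a sum_distrib_left
    by (rule sum.cong) (auto simp: power_mult_distrib prod.distrib power_sum[symmetric] mult_ac)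
qed

lemma form_at_zero: "form d F \<Longrightarrow> 0 < d \<Longrightarrow> F 0 = 0"
  using form_homogeneous[of d F 0 0] by (simp add: power_0_left)

lemma form_0_const: "form 0 F \<Longrightarrow> F v = F w"
  using form_homogeneous[of 0 F 0 v] form_homogeneous[of 0 F 0 w] by simp

text \<open>
  This reduces questions about the zeros of forms on a variety swept out by rational curves to
  polynomials in one variable.
\<close>

lemma form_along_polynomial_curve:
  fixes \<gamma> :: "'n::finite \<Rightarrow> complex poly"
  assumes "form d F"
  obtains p where "\<And>t. F (\<chi> i. poly (\<gamma> i) t) = poly p t"
proof -
  obtain a where a: "\<And>v. F v = (\<Sum>\<alpha> | sum \<alpha> UNIV = d. a \<alpha> * (\<Prod>i\<in>UNIV. (v $ i) ^ \<alpha> i))"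
    using assms(1) unfolding form_def by blast
  show ?thesis
    by (rule that[of "\<Sum>\<alpha> | sum \<alpha> UNIV = d. [:a \<alpha>:] * (\<Prod>i\<in>UNIV. \<gamma> i ^ \<alpha> i)"])
      (simp add: a poly_sum poly_prod poly_power)
qed

section \<open>Irreducible cones and their function fields\<close>

text \<open>
  Irreducibility says that the vanishing ideal is prime. Testing it on forms suffices, because the
  vanishing ideal of a set closed under scaling is generated by forms.
\<close>

locale irreducible_cone =
  fixes V :: "(complex ^ 'n) set"
  assumes nonempty: "V \<noteq> {}"
    and nonzero: "v \<in> V \<Longrightarrow> v \<noteq> 0"
    and scale: "v \<in> V \<Longrightarrow> c \<noteq> 0 \<Longrightarrow> c *s v \<in> V"
    and irreducible: "form d F \<Longrightarrow> form e G \<Longrightarrow> \<forall>v\<in>V. F v * G v = 0 \<Longrightarrow>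
      (\<forall>v\<in>V. F v = 0) \<or> (\<forall>v\<in>V. G v = 0)"

text \<open>
  Along a polynomial curve through representatives of two points, a form becomes a polynomial in
  the parameter; if neither of two forms vanishes at its own end, then neither polynomial is zero,
  so their product is not zero either.
\<close>

lemma irreducible_coneI:
  fixes V :: "(complex ^ 'n) set"
  assumes "V \<noteq> {}" and nz: "0 \<notin> V"
    and scale: "\<And>v c. v \<in> V \<Longrightarrow> c \<noteq> 0 \<Longrightarrow> c *s v \<in> V"
    and joined: "\<And>v w. v \<in> V \<Longrightarrow> w \<in> V \<Longrightarrow> \<exists>\<gamma> a b. a \<noteq> 0 \<and> b \<noteq> 0 \<and>
      (\<chi> i. poly (\<gamma> i) 0) = a *s v \<and> (\<chi> i. poly (\<gamma> i) 1) = b *s w \<and>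
      (\<forall>t. (\<chi> i. poly (\<gamma> i) t) \<noteq> 0 \<longrightarrow> (\<chi> i. poly (\<gamma> i) t) \<in> V)"
  shows "irreducible_cone V"
proof
  show "V \<noteq> {}" by fact
  show "v \<noteq> 0" if "v \<in> V" for v using that nz by auto
  show "c *s v \<in> V" if "v \<in> V" "c \<noteq> 0" for v c using that by (rule scale)
  fix d e F G
  assume F: "form d F" and G: "form e G" and FG: "\<forall>v\<in>V. F v * G v = 0"
  show "(\<forall>v\<in>V. F v = 0) \<or> (\<forall>v\<in>V. G v = 0)"
  proof (rule ccontr)
    assume "\<not> ?thesis"
    then obtain v w where v: "v \<in> V" "F v \<noteq> 0" and w: "w \<in> V" "G w \<noteq> 0" by blast
    then obtain \<gamma> a b where ab: "a \<noteq> 0" "b \<noteq> 0"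
      and ends: "(\<chi> i. poly (\<gamma> i) 0) = a *s v" "(\<chi> i. poly (\<gamma> i) 1) = b *s w"
      and in_V: "\<And>t. (\<chi> i. poly (\<gamma> i) t) \<noteq> 0 \<Longrightarrow> (\<chi> i. poly (\<gamma> i) t) \<in> V"
      using joined[OF v(1) w(1)] by blast
    obtain p where p: "\<And>t. F (\<chi> i. poly (\<gamma> i) t) = poly p t"
      using form_along_polynomial_curve[OF F] by blast
    obtain q where q: "\<And>t. G (\<chi> i. poly (\<gamma> i) t) = poly q t"
      using form_along_polynomial_curve[OF G] by blast
    have "p \<noteq> 0"
      using p[of 0] v ab by (auto simp: ends form_homogeneous[OF F])
    moreover have "q \<noteq> 0"
      using q[of 1] w ab by (auto simp: ends form_homogeneous[OF G])
    moreover obtain i where "\<gamma> i \<noteq> 0"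
    proof -
      have "v \<noteq> 0" using v nz by auto
      then have "(\<chi> i. poly (\<gamma> i) 0) \<noteq> 0" using ab by (auto simp: ends)
      then obtain i where "poly (\<gamma> i) 0 \<noteq> 0" by (auto simp: vec_eq_iff)
      then have "\<gamma> i \<noteq> 0" by auto
      then show ?thesis by (rule that)
    qed
    ultimately have "p * q * \<gamma> i \<noteq> 0" by simp
    \<comment> \<open>The factor \<open>\<gamma> i\<close> takes care of the parameters at which the curve passes through the origin.\<close>
    moreover have "poly (p * q * \<gamma> i) t = 0" for t
    proof (cases "(\<chi> i. poly (\<gamma> i) t) = 0")
      case True
      then show ?thesis by (simp add: vec_eq_iff)
    next
      case False
      then show ?thesis using in_V[of t] FG by (simp add: p[symmetric] q[symmetric])
    qed
    ultimately show False using poly_all_0_iff_0 by blast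
  qed
qed

context irreducible_cone
begin

lemma vanish_cancel:
  assumes "form d F" "form e G" "\<exists>v\<in>V. G v \<noteq> 0" "\<forall>v\<in>V. G v \<noteq> 0 \<longrightarrow> F v = 0"
  shows "\<forall>v\<in>V. F v = 0"
  using irreducible[OF assms(1,2)] assms(3,4) by fastforce

lemma nonvanishing_mult:
  assumes "form d F" "form e G" "\<exists>v\<in>V. F v \<noteq> 0" "\<exists>v\<in>V. G v \<noteq> 0"
  shows "\<exists>v\<in>V. F v * G v \<noteq> 0"
  using irreducible[OF assms(1,2)] assms(3,4) by blast

lemma fractionsI: "form d A \<Longrightarrow> form d B \<Longrightarrow> \<exists>v\<in>V. B v \<noteq> 0 \<Longrightarrow> (A, B) \<in> fractions V"
  unfolding fractions_def by blast

lemma fractionsE: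
  assumes "(A, B) \<in> fractions V"
  obtains d where "form d A" "form d B" "\<exists>v\<in>V. B v \<noteq> 0"
  using assms unfolding fractions_def by blast

text \<open>Transitivity amounts to cancelling the middle denominator, which is where irreducibility enters.\<close>

lemma equiv_frac_rel: "equiv (fractions V) (frac_rel V)"
proof (rule equivI)
  show "frac_rel V \<subseteq> fractions V \<times> fractions V"
    unfolding frac_rel_def by auto
  show "refl_on (fractions V) (frac_rel V)"
    unfolding frac_rel_def refl_on_def by auto
  show "sym (frac_rel V)"
    unfolding frac_rel_def sym_def by auto
  show "trans (frac_rel V)"
  proof (rule transI, clarify)
    fix A B A' B' A'' B''
    assume 1: "((A, B), (A', B')) \<in> frac_rel V" and 2: "((A', B'), (A'', B'')) \<in> frac_rel V"
    obtain d where d: "form d A" "form d B" using 1 unfolding frac_rel_def fractions_def by auto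
    obtain e where e: "form e B'" "\<exists>v\<in>V. B' v \<noteq> 0" using 1 unfolding frac_rel_def fractions_def by auto
    obtain f where f: "form f A''" "form f B''" using 2 unfolding frac_rel_def fractions_def by auto
    have "\<forall>v\<in>V. A v * B'' v - A'' v * B v = 0"
    proof (rule vanish_cancel[OF form_diff e])
      show "form (d + f) (\<lambda>v. A v * B'' v)" using d f by (intro form_mult)
      show "form (d + f) (\<lambda>v. A'' v * B v)" using form_mult[OF f(1) d(2)] by (simp add: add.commute)
      show "\<forall>v\<in>V. B' v \<noteq> 0 \<longrightarrow> A v * B'' v - A'' v * B v = 0"
      proof (intro ballI impI)
        fix v assume v: "v \<in> V" "B' v \<noteq> 0"
        have "A v * B' v = A' v * B v" "A' v * B'' v = A'' v * B' v"
          using 1 2 v unfolding frac_rel_def by auto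
        moreover have "B' v * (A v * B'' v - A'' v * B v) = (A v * B' v) * B'' v - (A'' v * B' v) * B v"
          by (simp add: algebra_simps)
        ultimately have "B' v * (A v * B'' v - A'' v * B v) = 0" by (metis mult.assoc mult.commute diff_self)
        then show "A v * B'' v - A'' v * B v = 0" using v by simp
      qed
    qed
    then show "((A, B), (A'', B'')) \<in> frac_rel V"
      using 1 2 unfolding frac_rel_def by auto
  qed
qed

abbreviation frac :: "(complex ^ 'n \<Rightarrow> complex) \<Rightarrow> (complex ^ 'n \<Rightarrow> complex) \<Rightarrow> 'n ratfun" where
  "frac A B \<equiv> frac_rel V `` {(A, B)}"

abbreviation L :: "'n ratfun ring" where "L \<equiv> function_field V"

lemma frac_eq:
  assumes "(A, B) \<in> fractions V" "(A', B') \<in> fractions V" "\<And>v. v \<in> V \<Longrightarrow> A v * B' v = A' v * B v"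
  shows "frac A B = frac A' B'"
  by (rule equiv_class_eq[OF equiv_frac_rel]) (use assms in \<open>auto simp: frac_rel_def\<close>)

lemma frac_eqD:
  assumes "frac A B = frac A' B'" "(A, B) \<in> fractions V" "(A', B') \<in> fractions V" "v \<in> V"
  shows "A v * B' v = A' v * B v"
  using eq_equiv_class[OF assms(1) equiv_frac_rel assms(3)] assms(4) unfolding frac_rel_def by auto

lemma frac_closed: "(A, B) \<in> fractions V \<Longrightarrow> frac A B \<in> carrier L"
  unfolding function_field_def by (simp add: quotientI)

lemma carrierE:
  assumes "x \<in> carrier L"
  obtains d A B where "form d A" "form d B" "\<exists>v\<in>V. B v \<noteq> 0" "(A, B) \<in> fractions V" "x = frac A B"
  using assms unfolding function_field_def fractions_def by (auto elim!: quotientE)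

lemma fractions_mult:
  assumes "(A, B) \<in> fractions V" "(A', B') \<in> fractions V"
  shows "(\<lambda>v. A v * A' v, \<lambda>v. B v * B' v) \<in> fractions V"
  using assms by (auto elim!: fractionsE intro!: fractionsI form_mult nonvanishing_mult simp del: mult_eq_0_iff)

lemma fractions_add:
  assumes "(A, B) \<in> fractions V" "(A', B') \<in> fractions V"
  shows "(\<lambda>v. A v * B' v + A' v * B v, \<lambda>v. B v * B' v) \<in> fractions V"
proof -
  obtain d where d: "form d A" "form d B" "\<exists>v\<in>V. B v \<noteq> 0" using assms(1) by (rule fractionsE)
  obtain e where e: "form e A'" "form e B'" "\<exists>v\<in>V. B' v \<noteq> 0" using assms(2) by (rule fractionsE)
  show ?thesis
  proof (rule fractionsI)
    show "form (d + e) (\<lambda>v. A v * B' v + A' v * B v)"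
      using form_add[OF form_mult[OF d(1) e(2)] form_mult[OF e(1) d(2), unfolded add.commute[of e]]] .
    show "form (d + e) (\<lambda>v. B v * B' v)" using d e by (intro form_mult)
    show "\<exists>v\<in>V. B v * B' v \<noteq> 0" using nonvanishing_mult d e by blast
  qed
qed

lemma frac_mult:
  assumes "(A, B) \<in> fractions V" "(A', B') \<in> fractions V"
  shows "frac A B \<otimes>\<^bsub>L\<^esub> frac A' B' = frac (\<lambda>v. A v * A' v) (\<lambda>v. B v * B' v)"
proof -
  let ?f = "\<lambda>(A, B) (A', B'). frac (\<lambda>v. A v * A' v) (\<lambda>v. B v * B' v)"
  have "congruent2 (frac_rel V) (frac_rel V) ?f"
  proof (rule congruent2I', clarify)
    fix A B A' B' C D C' D'
    assume 1: "((A, B), (A', B')) \<in> frac_rel V" and 2: "((C, D), (C', D')) \<in> frac_rel V"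
    show "frac (\<lambda>v. A v * C v) (\<lambda>v. B v * D v) = frac (\<lambda>v. A' v * C' v) (\<lambda>v. B' v * D' v)"
    proof (rule frac_eq[OF fractions_mult fractions_mult])
      fix v assume v: "v \<in> V"
      have "(A v * B' v) * (C v * D' v) = (A' v * B v) * (C' v * D v)"
        using 1 2 v by (simp add: frac_rel_def)
      then show "A v * C v * (B' v * D' v) = A' v * C' v * (B v * D v)" by (simp add: mult_ac)
    qed (use 1 2 in \<open>auto simp: frac_rel_def\<close>)
  qed
  from UN_equiv_class2[OF equiv_frac_rel equiv_frac_rel this assms]
  show ?thesis unfolding function_field_def by (simp add: case_prod_unfold)
qed

lemma frac_add:
  assumes "(A, B) \<in> fractions V" "(A', B') \<in> fractions V"
  shows "frac A B \<oplus>\<^bsub>L\<^esub> frac A' B' = frac (\<lambda>v. A v * B' v + A' v * B v) (\<lambda>v. B v * B' v)"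
proof -
  let ?f = "\<lambda>(A, B) (A', B'). frac (\<lambda>v. A v * B' v + A' v * B v) (\<lambda>v. B v * B' v)"
  have "congruent2 (frac_rel V) (frac_rel V) ?f"
  proof (rule congruent2I', clarify)
    fix A B A' B' C D C' D'
    assume 1: "((A, B), (A', B')) \<in> frac_rel V" and 2: "((C, D), (C', D')) \<in> frac_rel V"
    show "frac (\<lambda>v. A v * D v + C v * B v) (\<lambda>v. B v * D v) = frac (\<lambda>v. A' v * D' v + C' v * B' v) (\<lambda>v. B' v * D' v)"
    proof (rule frac_eq[OF fractions_add fractions_add])
      fix v assume v: "v \<in> V"
      have "(A v * B' v) * (D v * D' v) + (C v * D' v) * (B v * B' v)
          = (A' v * B v) * (D v * D' v) + (C' v * D v) * (B v * B' v)"
        using 1 2 v by (simp add: frac_rel_def)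
      then show "(A v * D v + C v * B v) * (B' v * D' v) = (A' v * D' v + C' v * B' v) * (B v * D v)"
        by (simp add: algebra_simps)
    qed (use 1 2 in \<open>auto simp: frac_rel_def\<close>)
  qed
  from UN_equiv_class2[OF equiv_frac_rel equiv_frac_rel this assms]
  show ?thesis unfolding function_field_def by (simp add: case_prod_unfold)
qed

lemma one_frac: "\<one>\<^bsub>L\<^esub> = frac (\<lambda>v. 1) (\<lambda>v. 1)" and zero_frac: "\<zero>\<^bsub>L\<^esub> = frac (\<lambda>v. 0) (\<lambda>v. 1)"
  unfolding function_field_def by simp_all

lemma fractions_const: "(\<lambda>v. c, \<lambda>v. 1) \<in> fractions V"
  using nonempty by (intro fractionsI[OF form_const form_const]) auto

end

section \<open>The group of birational transformations\<close>

context irreducible_cone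
begin

lemma rational_mapE:
  assumes "rational_map V V \<Phi>"
  obtains d k where "\<And>i. form d (\<lambda>v. \<Phi> v $ i)" "\<exists>v\<in>V. \<Phi> v $ k \<noteq> 0" "\<And>v. v \<in> V \<Longrightarrow> \<Phi> v \<noteq> 0 \<Longrightarrow> \<Phi> v \<in> V"
  using assms unfolding rational_map_def by (metis vec_eq_iff zero_index)

definition dominant :: "(complex ^ 'n \<Rightarrow> complex ^ 'n) \<Rightarrow> bool" where
  "dominant \<Phi> \<longleftrightarrow> rational_map V V \<Phi> \<and>
     (\<forall>e B. form e B \<longrightarrow> (\<exists>v\<in>V. B v \<noteq> 0) \<longrightarrow> (\<exists>v\<in>V. B (\<Phi> v) \<noteq> 0))"

lemma dominantD:
  "dominant \<Phi> \<Longrightarrow> rational_map V V \<Phi>"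
  "dominant \<Phi> \<Longrightarrow> form e B \<Longrightarrow> \<exists>v\<in>V. B v \<noteq> 0 \<Longrightarrow> \<exists>v\<in>V. B (\<Phi> v) \<noteq> 0"
  unfolding dominant_def by blast+

text \<open>
  The value at the origin matters when the inner map of a composite vanishes: it is \<open>0\<close> unless
  the forms have degree zero, in which case the map is constant.
\<close>

lemma rational_map_value_at_zero:
  assumes "rational_map V V \<Phi>" "\<Phi> 0 \<noteq> 0"
  shows "\<Phi> 0 \<in> V"
proof -
  obtain d k where d: "\<And>i. form d (\<lambda>v. \<Phi> v $ i)" "\<And>v. v \<in> V \<Longrightarrow> \<Phi> v \<noteq> 0 \<Longrightarrow> \<Phi> v \<in> V"
    using rational_mapE[OF assms(1)] by metis
  obtain w where w: "w \<in> V" using nonempty by blast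
  have "d = 0" using assms(2) form_at_zero[OF d(1)] by (force simp: vec_eq_iff)
  then have "\<Phi> 0 = \<Phi> w" using d(1) form_0_const by (metis vec_eq_iff)
  then show ?thesis using d(2) w assms(2) by metis
qed

lemma rational_map_comp:
  assumes "rational_map V V \<Phi>" "dominant \<Psi>"
  shows "rational_map V V (\<Phi> \<circ> \<Psi>)"
proof -
  obtain d k where \<Phi>: "\<And>i. form d (\<lambda>v. \<Phi> v $ i)" "\<exists>v\<in>V. \<Phi> v $ k \<noteq> 0" "\<And>v. v \<in> V \<Longrightarrow> \<Phi> v \<noteq> 0 \<Longrightarrow> \<Phi> v \<in> V"
    using assms(1) by (rule rational_mapE) blast
  obtain e where \<Psi>: "\<And>i. form e (\<lambda>v. \<Psi> v $ i)" "\<And>v. v \<in> V \<Longrightarrow> \<Psi> v \<noteq> 0 \<Longrightarrow> \<Psi> v \<in> V"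
    using dominantD(1)[OF assms(2)] by (rule rational_mapE) blast
  show ?thesis
    unfolding rational_map_def
  proof (intro conjI exI allI ballI impI)
    show "form (d * e) (\<lambda>v. (\<Phi> \<circ> \<Psi>) v $ i)" for i
      using form_comp[OF \<Phi>(1) \<Psi>(1)] by (simp add: comp_def)
    show "\<exists>v\<in>V. (\<Phi> \<circ> \<Psi>) v \<noteq> 0"
      using dominantD(2)[OF assms(2) \<Phi>(1,2)] by (auto simp: vec_eq_iff)
    show "(\<Phi> \<circ> \<Psi>) v \<in> V" if "v \<in> V" "(\<Phi> \<circ> \<Psi>) v \<noteq> 0" for v
      using that \<Phi>(3) \<Psi>(2) rational_map_value_at_zero[OF assms(1)] by (cases "\<Psi> v = 0") auto
  qed
qed

lemma dominant_comp:
  assumes "dominant \<Phi>" "dominant \<Psi>"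
  shows "dominant (\<Phi> \<circ> \<Psi>)"
  unfolding dominant_def
proof (intro conjI allI impI)
  show "rational_map V V (\<Phi> \<circ> \<Psi>)" using rational_map_comp assms dominantD(1) by blast
  fix e B
  assume B: "form e B" "\<exists>v\<in>V. B v \<noteq> 0"
  obtain d where d: "\<And>i. form d (\<lambda>v. \<Phi> v $ i)"
    using dominantD(1)[OF assms(1)] by (rule rational_mapE) blast
  have "\<exists>v\<in>V. (B \<circ> \<Phi>) v \<noteq> 0" using dominantD(2)[OF assms(1) B] by simp
  then show "\<exists>v\<in>V. B ((\<Phi> \<circ> \<Psi>) v) \<noteq> 0"
    using dominantD(2)[OF assms(2) form_comp[OF B(1) d]] by simp
qed

lemma same_map_refl: "same_map V \<Phi> \<Phi>"
  unfolding same_map_def by (simp add: mult.commute)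

lemma same_map_sym: "same_map V \<Phi> \<Psi> \<Longrightarrow> same_map V \<Psi> \<Phi>"
  unfolding same_map_def by (simp add: mult.commute)

lemma form_minor:
  assumes "\<And>i. form d (\<lambda>v. \<Phi> v $ i)" "\<And>i. form e (\<lambda>v. \<Psi> v $ i)"
  shows "form (d + e) (\<lambda>v. \<Phi> v $ i * \<Psi> v $ j - \<Phi> v $ j * \<Psi> v $ i)"
  using assms by (intro form_diff form_mult)

lemma same_map_trans:
  assumes "rational_map V V \<Phi>" "rational_map V V \<Psi>" "rational_map V V \<Xi>"
    and "same_map V \<Phi> \<Psi>" "same_map V \<Psi> \<Xi>"
  shows "same_map V \<Phi> \<Xi>"
proof -
  obtain d where \<Phi>: "\<And>i. form d (\<lambda>v. \<Phi> v $ i)" using assms(1) by (rule rational_mapE) blast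
  obtain e k where \<Psi>: "\<And>i. form e (\<lambda>v. \<Psi> v $ i)" "\<exists>v\<in>V. \<Psi> v $ k \<noteq> 0"
    using assms(2) by (rule rational_mapE) blast
  obtain f where \<Xi>: "\<And>i. form f (\<lambda>v. \<Xi> v $ i)" using assms(3) by (rule rational_mapE) blast
  have "\<forall>v\<in>V. \<Phi> v $ i * \<Xi> v $ j - \<Phi> v $ j * \<Xi> v $ i = 0" for i j
  proof (rule vanish_cancel[OF form_minor[OF \<Phi> \<Xi>] \<Psi>], intro ballI impI)
    fix v assume v: "v \<in> V" "\<Psi> v $ k \<noteq> 0"
    have 1: "\<Phi> v $ a * \<Psi> v $ b = \<Phi> v $ b * \<Psi> v $ a" for a b
      using assms(4) v(1) unfolding same_map_def by blast
    have 2: "\<Psi> v $ a * \<Xi> v $ b = \<Psi> v $ b * \<Xi> v $ a" for a b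
      using assms(5) v(1) unfolding same_map_def by blast
    have "\<Psi> v $ k * (\<Phi> v $ i * \<Xi> v $ j) = \<Psi> v $ k * (\<Phi> v $ j * \<Xi> v $ i)"
      using 1[of i k] 1[of j k] 2[of i j] by (metis mult.assoc mult.commute)
    then show "\<Phi> v $ i * \<Xi> v $ j - \<Phi> v $ j * \<Xi> v $ i = 0" using v(2) by simp
  qed
  then show ?thesis unfolding same_map_def by simp
qed

text \<open>
  Replacing the inner map by a proportional one rescales the value of the outer map, by
  homogeneity, at every point where both inner values are nonzero; irreducibility covers the rest.
\<close>

lemma same_map_comp:
  assumes maps: "rational_map V V \<Phi>" "rational_map V V \<Phi>'" "rational_map V V \<Psi>" "rational_map V V \<Psi>'"
    and same: "same_map V \<Phi> \<Phi>'" "same_map V \<Psi> \<Psi>'"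
  shows "same_map V (\<Phi> \<circ> \<Psi>) (\<Phi>' \<circ> \<Psi>')"
proof -
  obtain d where \<Phi>: "\<And>i. form d (\<lambda>v. \<Phi> v $ i)" using maps(1) by (rule rational_mapE) blast
  obtain d' where \<Phi>': "\<And>i. form d' (\<lambda>v. \<Phi>' v $ i)" using maps(2) by (rule rational_mapE) blast
  obtain e k where \<Psi>: "\<And>i. form e (\<lambda>v. \<Psi> v $ i)" "\<exists>v\<in>V. \<Psi> v $ k \<noteq> 0" "\<And>v. v \<in> V \<Longrightarrow> \<Psi> v \<noteq> 0 \<Longrightarrow> \<Psi> v \<in> V"
    using maps(3) by (rule rational_mapE) blast
  obtain e' k' where \<Psi>': "\<And>i. form e' (\<lambda>v. \<Psi>' v $ i)" "\<exists>v\<in>V. \<Psi>' v $ k' \<noteq> 0"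
    using maps(4) by (rule rational_mapE) blast
  have F: "form (d * e) (\<lambda>v. (\<Phi> \<circ> \<Psi>) v $ i)" for i
    using form_comp[OF \<Phi> \<Psi>(1)] by (simp add: comp_def)
  have F': "form (d' * e') (\<lambda>v. (\<Phi>' \<circ> \<Psi>') v $ i)" for i
    using form_comp[OF \<Phi>' \<Psi>'(1)] by (simp add: comp_def)
  have "\<forall>v\<in>V. (\<Phi> \<circ> \<Psi>) v $ i * (\<Phi>' \<circ> \<Psi>') v $ j - (\<Phi> \<circ> \<Psi>) v $ j * (\<Phi>' \<circ> \<Psi>') v $ i = 0" for i j
  proof (rule vanish_cancel[OF form_minor[OF F F'] form_mult[OF \<Psi>(1)[of k] \<Psi>'(1)[of k']]])
    show "\<exists>v\<in>V. \<Psi> v $ k * \<Psi>' v $ k' \<noteq> 0" using nonvanishing_mult \<Psi> \<Psi>' by blast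
    show "\<forall>v\<in>V. \<Psi> v $ k * \<Psi>' v $ k' \<noteq> 0 \<longrightarrow>
        (\<Phi> \<circ> \<Psi>) v $ i * (\<Phi>' \<circ> \<Psi>') v $ j - (\<Phi> \<circ> \<Psi>) v $ j * (\<Phi>' \<circ> \<Psi>') v $ i = 0"
    proof (intro ballI impI)
      fix v assume v: "v \<in> V" "\<Psi> v $ k * \<Psi>' v $ k' \<noteq> 0"
      define c where "c = \<Psi>' v $ k / \<Psi> v $ k"
      have "\<Psi> v $ a * \<Psi>' v $ k = \<Psi> v $ k * \<Psi>' v $ a" for a
        using same(2) v(1) unfolding same_map_def by blast
      then have c: "\<Psi>' v = c *s \<Psi> v"
        using v(2) by (simp add: vec_eq_iff c_def field_simps)
      have "\<Psi> v \<in> V" using \<Psi>(3) v by force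
      then have "\<Phi> (\<Psi> v) $ i * \<Phi>' (\<Psi> v) $ j = \<Phi> (\<Psi> v) $ j * \<Phi>' (\<Psi> v) $ i"
        using same(1) unfolding same_map_def by blast
      then show "(\<Phi> \<circ> \<Psi>) v $ i * (\<Phi>' \<circ> \<Psi>') v $ j - (\<Phi> \<circ> \<Psi>) v $ j * (\<Phi>' \<circ> \<Psi>') v $ i = 0"
        by (simp add: c form_homogeneous[OF \<Phi>'] mult.left_commute)
    qed
  qed
  then show ?thesis unfolding same_map_def by simp
qed

lemma rational_map_id: "rational_map V V id"
  unfolding rational_map_def using nonempty nonzero form_coord by fastforce

lemma birational_imp_rational_map: "birational V \<Phi> \<Longrightarrow> rational_map V V \<Phi>"
  unfolding birational_def by blast

text \<open>
  A form that vanishes after substituting \<open>\<Phi>\<close> also vanishes after substituting \<open>\<Phi> \<circ> \<Psi>\<close>, which is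
  a multiple of the identity when \<open>\<Psi>\<close> is inverse to \<open>\<Phi>\<close>.
\<close>

lemma birational_imp_dominant:
  assumes "birational V \<Phi>"
  shows "dominant \<Phi>"
  unfolding dominant_def
proof (intro conjI allI impI)
  show "rational_map V V \<Phi>" using assms by (rule birational_imp_rational_map)
  fix e B
  assume B: "form e B" "\<exists>v\<in>V. B v \<noteq> 0"
  obtain \<Psi> where \<Psi>: "rational_map V V \<Psi>" "rational_map V V (\<Phi> \<circ> \<Psi>)" "same_map V (\<Phi> \<circ> \<Psi>) id"
    using assms unfolding birational_def by blast
  obtain d where d: "\<And>i. form d (\<lambda>v. \<Phi> v $ i)"
    using birational_imp_rational_map[OF assms] by (rule rational_mapE) blast
  obtain f k where f: "\<And>i. form f (\<lambda>v. (\<Phi> \<circ> \<Psi>) v $ i)" "\<exists>v\<in>V. (\<Phi> \<circ> \<Psi>) v $ k \<noteq> 0"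
    using \<Psi>(2) by (rule rational_mapE) blast
  show "\<exists>v\<in>V. B (\<Phi> v) \<noteq> 0"
  proof (rule ccontr)
    assume vanish: "\<not> ?thesis"
    have B\<Phi>: "B (\<Phi> v) = 0" if "\<Phi> v \<noteq> 0" "v \<in> V \<or> v = 0" for v
    proof (cases "v = 0")
      case True
      then have "d = 0" using that form_at_zero[OF d] by (force simp: vec_eq_iff)
      then have "\<Phi> v = \<Phi> w" for w using form_0_const d by (metis vec_eq_iff)
      then show ?thesis using vanish nonempty by (metis ex_in_conv)
    qed (use that vanish in blast)
    have "\<forall>v\<in>V. B v = 0"
    proof (rule vanish_cancel[OF B(1) f], intro ballI impI)
      fix v assume v: "v \<in> V" "(\<Phi> \<circ> \<Psi>) v $ k \<noteq> 0"
      define c where "c = v $ k / (\<Phi> \<circ> \<Psi>) v $ k"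
      have "(\<Phi> \<circ> \<Psi>) v $ k * v $ a = (\<Phi> \<circ> \<Psi>) v $ a * v $ k" for a
        using \<Psi>(3) v(1) unfolding same_map_def by simp
      then have c: "v = c *s (\<Phi> (\<Psi> v))"
        using v(2) by (simp add: vec_eq_iff c_def field_simps)
      have "\<Psi> v \<in> V \<or> \<Psi> v = 0" using v(1) \<Psi>(1) unfolding rational_map_def by blast
      then have "B (\<Phi> (\<Psi> v)) = 0" using B\<Phi>[of "\<Psi> v"] v(2) by force
      then show "B v = 0" using c form_homogeneous[OF B(1)] by (metis mult_zero_right)
    qed
    then show False using B(2) by blast
  qed
qed

lemma birational_inverseE:
  assumes "birational V \<Phi>"
  obtains \<Psi> where "birational V \<Psi>" "same_map V (\<Psi> \<circ> \<Phi>) id" "same_map V (\<Phi> \<circ> \<Psi>) id"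
  using assms unfolding birational_def by blast

lemma birational_id: "birational V id"
  unfolding birational_def using rational_map_id by (auto intro!: exI[of _ id] same_map_refl)

text \<open>The usual way to exhibit an inverse: both composites multiply by a nonzero form.\<close>

lemma birationalI:
  assumes "\<And>i. form d (\<lambda>v. \<Phi> v $ i)" "\<And>i. form e (\<lambda>v. \<Psi> v $ i)"
    and V: "\<And>v. v \<in> V \<Longrightarrow> \<Phi> v \<noteq> 0 \<Longrightarrow> \<Phi> v \<in> V" "\<And>v. v \<in> V \<Longrightarrow> \<Psi> v \<noteq> 0 \<Longrightarrow> \<Psi> v \<in> V"
    and inv: "\<And>v. \<Psi> (\<Phi> v) = g v *s v" "\<And>v. \<Phi> (\<Psi> v) = h v *s v"
    and at: "w \<in> V" "g w \<noteq> 0" "h w \<noteq> 0" "\<Phi> w \<noteq> 0" "\<Psi> w \<noteq> 0"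
  shows "birational V \<Phi>"
proof -
  have "rational_map V V \<Phi>" "rational_map V V \<Psi>"
    unfolding rational_map_def using assms by blast+
  moreover have "rational_map V V (\<Psi> \<circ> \<Phi>)"
    unfolding rational_map_def
    using form_comp[OF assms(2,1)] at nonzero scale by (auto simp: comp_def inv intro!: exI[of _ "e * d"] bexI[of _ w])
  moreover have "rational_map V V (\<Phi> \<circ> \<Psi>)"
    unfolding rational_map_def
    using form_comp[OF assms(1,2)] at nonzero scale by (auto simp: comp_def inv intro!: exI[of _ "d * e"] bexI[of _ w])
  moreover have "same_map V (\<Psi> \<circ> \<Phi>) id" "same_map V (\<Phi> \<circ> \<Psi>) id"
    unfolding same_map_def by (simp_all add: inv)
  ultimately show ?thesis unfolding birational_def by blast
qed

lemma same_map_inverse_comp: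
  assumes "birational V \<Phi>" "birational V \<Phi>'" "birational V \<Psi>" "birational V \<Psi>'"
    and "same_map V (\<Phi>' \<circ> \<Phi>) id" "same_map V (\<Psi>' \<circ> \<Psi>) id"
  shows "same_map V ((\<Psi>' \<circ> \<Phi>') \<circ> (\<Phi> \<circ> \<Psi>)) id"
proof -
  note dom = assms(1-4)[THEN birational_imp_dominant]
  note dom_comp = dominant_comp[THEN dominantD(1)] dominantD(1)
  have "same_map V ((\<Phi>' \<circ> \<Phi>) \<circ> \<Psi>) (id \<circ> \<Psi>)"
    using assms(5) dom by (intro same_map_comp dom_comp rational_map_id same_map_refl)
  then have "same_map V (\<Psi>' \<circ> ((\<Phi>' \<circ> \<Phi>) \<circ> \<Psi>)) (\<Psi>' \<circ> \<Psi>)"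
    using dom by (intro same_map_comp dom_comp dominant_comp same_map_refl) auto
  then show ?thesis
    unfolding comp_assoc
    by (rule same_map_trans[rotated 3]) (use dom assms(6) in \<open>auto intro!: dom_comp dominant_comp rational_map_id\<close>)
qed

lemma birational_comp:
  assumes "birational V \<Phi>" "birational V \<Psi>"
  shows "birational V (\<Phi> \<circ> \<Psi>)"
proof -
  obtain \<Phi>' where \<Phi>': "birational V \<Phi>'" "same_map V (\<Phi>' \<circ> \<Phi>) id" "same_map V (\<Phi> \<circ> \<Phi>') id"
    using assms(1) by (rule birational_inverseE)
  obtain \<Psi>' where \<Psi>': "birational V \<Psi>'" "same_map V (\<Psi>' \<circ> \<Psi>) id" "same_map V (\<Psi> \<circ> \<Psi>') id"
    using assms(2) by (rule birational_inverseE)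
  note dom = assms[THEN birational_imp_dominant] \<Phi>'(1)[THEN birational_imp_dominant]
    \<Psi>'(1)[THEN birational_imp_dominant]
  have "same_map V ((\<Psi>' \<circ> \<Phi>') \<circ> (\<Phi> \<circ> \<Psi>)) id" "same_map V ((\<Phi> \<circ> \<Psi>) \<circ> (\<Psi>' \<circ> \<Phi>')) id"
    using same_map_inverse_comp assms \<Phi>' \<Psi>' by blast+
  then show ?thesis
    unfolding birational_def using dom by (blast intro: dominantD(1) dominant_comp)
qed

lemma equiv_bir_rel: "equiv (Collect (birational V)) (bir_rel V)"
proof (rule equivI)
  show "bir_rel V \<subseteq> Collect (birational V) \<times> Collect (birational V)"
    unfolding bir_rel_def by auto
  show "refl_on (Collect (birational V)) (bir_rel V)"
    unfolding bir_rel_def refl_on_def by (auto simp: same_map_refl)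
  show "sym (bir_rel V)"
    unfolding bir_rel_def sym_def by (auto intro: same_map_sym)
  show "trans (bir_rel V)"
    unfolding bir_rel_def trans_def
    by (auto intro: same_map_trans[OF birational_imp_rational_map birational_imp_rational_map birational_imp_rational_map])
qed

abbreviation bir_class :: "(complex ^ 'n \<Rightarrow> complex ^ 'n) \<Rightarrow> (complex ^ 'n \<Rightarrow> complex ^ 'n) set" where
  "bir_class \<Phi> \<equiv> bir_rel V `` {\<Phi>}"

lemma bir_class_eq: "birational V \<Phi> \<Longrightarrow> birational V \<Psi> \<Longrightarrow> same_map V \<Phi> \<Psi> \<Longrightarrow> bir_class \<Phi> = bir_class \<Psi>"
  by (rule equiv_class_eq[OF equiv_bir_rel]) (simp add: bir_rel_def)

lemma bir_class_self: "birational V \<Phi> \<Longrightarrow> \<Phi> \<in> bir_class \<Phi>"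
  by (rule equiv_class_self[OF equiv_bir_rel]) simp

lemma bir_class_closed: "birational V \<Phi> \<Longrightarrow> bir_class \<Phi> \<in> carrier (Bir V)"
  unfolding Bir_def by (simp add: quotientI)

lemma bir_carrierE:
  assumes "f \<in> carrier (Bir V)"
  obtains \<Phi> where "birational V \<Phi>" "f = bir_class \<Phi>"
  using assms unfolding Bir_def by (auto elim: quotientE)

lemma bir_class_mult:
  assumes "birational V \<Phi>" "birational V \<Psi>"
  shows "bir_class \<Phi> \<otimes>\<^bsub>Bir V\<^esub> bir_class \<Psi> = bir_class (\<Phi> \<circ> \<Psi>)"
proof -
  have "congruent2 (bir_rel V) (bir_rel V) (\<lambda>\<Phi> \<Psi>. bir_class (\<Phi> \<circ> \<Psi>))"
  proof (rule congruent2I')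
    fix \<Phi> \<Phi>' \<Psi> \<Psi>'
    assume "(\<Phi>, \<Phi>') \<in> bir_rel V" "(\<Psi>, \<Psi>') \<in> bir_rel V"
    then have "birational V \<Phi>" "birational V \<Phi>'" "birational V \<Psi>" "birational V \<Psi>'"
      "same_map V \<Phi> \<Phi>'" "same_map V \<Psi> \<Psi>'"
      unfolding bir_rel_def by auto
    then show "bir_class (\<Phi> \<circ> \<Psi>) = bir_class (\<Phi>' \<circ> \<Psi>')"
      by (intro bir_class_eq birational_comp same_map_comp birational_imp_rational_map)
  qed
  from UN_equiv_class2[OF equiv_bir_rel equiv_bir_rel this] show ?thesis
    using assms unfolding Bir_def by simp
qed

lemma group_Bir: "group (Bir V)"
proof (rule groupI)
  have one: "\<one>\<^bsub>Bir V\<^esub> = bir_class id" unfolding Bir_def by simp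
  fix f g h
  assume f: "f \<in> carrier (Bir V)"
  then obtain \<Phi> where \<Phi>: "birational V \<Phi>" "f = bir_class \<Phi>" by (rule bir_carrierE)
  show "\<one>\<^bsub>Bir V\<^esub> \<otimes>\<^bsub>Bir V\<^esub> f = f"
    using \<Phi> birational_id by (simp add: one bir_class_mult)
  obtain \<Psi> where \<Psi>: "birational V \<Psi>" "same_map V (\<Psi> \<circ> \<Phi>) id" using \<Phi>(1) by (rule birational_inverseE)
  then have "bir_class \<Psi> \<otimes>\<^bsub>Bir V\<^esub> f = \<one>\<^bsub>Bir V\<^esub>"
    using \<Phi> birational_id birational_comp by (simp add: one bir_class_mult bir_class_eq)
  then show "\<exists>y\<in>carrier (Bir V). y \<otimes>\<^bsub>Bir V\<^esub> f = \<one>\<^bsub>Bir V\<^esub>"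
    using bir_class_closed \<Psi>(1) by blast
  assume "g \<in> carrier (Bir V)"
  then obtain \<Gamma> where \<Gamma>: "birational V \<Gamma>" "g = bir_class \<Gamma>" by (rule bir_carrierE)
  show "f \<otimes>\<^bsub>Bir V\<^esub> g \<in> carrier (Bir V)"
    using \<Phi> \<Gamma> by (simp add: bir_class_mult bir_class_closed birational_comp)
  assume "h \<in> carrier (Bir V)"
  then obtain \<Xi> where \<Xi>: "birational V \<Xi>" "h = bir_class \<Xi>" by (rule bir_carrierE)
  show "f \<otimes>\<^bsub>Bir V\<^esub> g \<otimes>\<^bsub>Bir V\<^esub> h = f \<otimes>\<^bsub>Bir V\<^esub> (g \<otimes>\<^bsub>Bir V\<^esub> h)"
    using \<Phi> \<Gamma> \<Xi> by (simp add: bir_class_mult birational_comp comp_assoc)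
next
  show "\<one>\<^bsub>Bir V\<^esub> \<in> carrier (Bir V)"
    using bir_class_closed[OF birational_id] unfolding Bir_def by simp
qed

end

section \<open>Pullback of rational functions\<close>

context irreducible_cone
begin

text \<open>
  The definition of the pullback takes a union over all representatives, which need not behave
  alike: those whose denominator pulls back to zero contribute nothing, and all the others
  contribute the same class.
\<close>

lemma pullback_frac:
  fixes W :: "(complex ^ 'm) set"
  assumes \<Phi>: "\<And>i. form e (\<lambda>v. \<Phi> v $ i)" "\<And>v. v \<in> V \<Longrightarrow> \<Phi> v \<noteq> 0 \<Longrightarrow> \<Phi> v \<in> W"
    and AB: "(A, B) \<in> fractions W" and B: "\<exists>v\<in>V. B (\<Phi> v) \<noteq> 0"
  shows "pullback V \<Phi> (frac_rel W `` {(A, B)}) = frac (A \<circ> \<Phi>) (B \<circ> \<Phi>)"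
    and "(A \<circ> \<Phi>, B \<circ> \<Phi>) \<in> fractions V"
proof -
  obtain d where d: "form d A" "form d B" using AB unfolding fractions_def by blast
  show AB': "(A \<circ> \<Phi>, B \<circ> \<Phi>) \<in> fractions V"
    using form_comp[OF d(1) \<Phi>(1)] form_comp[OF d(2) \<Phi>(1)] B by (auto intro!: fractionsI)
  have same: "frac (A' \<circ> \<Phi>) (B' \<circ> \<Phi>) = frac (A \<circ> \<Phi>) (B \<circ> \<Phi>)"
    if rel: "((A, B), (A', B')) \<in> frac_rel W" and B': "\<exists>v\<in>V. B' (\<Phi> v) \<noteq> 0" for A' B'
  proof -
    obtain d' where d': "form d' A'" "form d' B'" using rel unfolding frac_rel_def fractions_def by blast
    have eq: "A w * B' w = A' w * B w" if "w \<in> W" for w using rel that unfolding frac_rel_def by blast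
    \<comment> \<open>At a base point of \<open>\<Phi>\<close> the equation reads at the origin, where forms of positive degree vanish.\<close>
    have eq0: "A 0 * B' 0 = A' 0 * B 0"
    proof (cases "d = 0 \<and> d' = 0")
      case True
      obtain w where "w \<in> W" using AB unfolding fractions_def by blast
      moreover from True d d' have "form 0 A" "form 0 B" "form 0 A'" "form 0 B'" by simp_all
      ultimately show ?thesis using eq form_0_const[of _ 0 w] by metis
    next
      case False
      then consider "0 < d" | "0 < d'" by blast
      then show ?thesis
        by cases (simp_all add: form_at_zero[OF d(1)] form_at_zero[OF d(2)] form_at_zero[OF d'(1)] form_at_zero[OF d'(2)])
    qed
    have AB'': "(A' \<circ> \<Phi>, B' \<circ> \<Phi>) \<in> fractions V"
      using form_comp[OF d'(1) \<Phi>(1)] form_comp[OF d'(2) \<Phi>(1)] B' by (auto intro!: fractionsI)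
    show ?thesis
    proof (rule frac_eq[OF AB'' AB'])
      fix v assume "v \<in> V"
      then show "(A' \<circ> \<Phi>) v * (B \<circ> \<Phi>) v = (A \<circ> \<Phi>) v * (B' \<circ> \<Phi>) v"
        using eq[of "\<Phi> v"] eq0 \<Phi>(2) by (cases "\<Phi> v = 0") auto
    qed
  qed
  have empty: "frac (A' \<circ> \<Phi>) (B' \<circ> \<Phi>) = {}" if "\<not> (\<exists>v\<in>V. B' (\<Phi> v) \<noteq> 0)" for A' B'
    using that unfolding frac_rel_def fractions_def by auto
  have self: "((A, B), (A, B)) \<in> frac_rel W" using AB unfolding frac_rel_def by auto
  show "pullback V \<Phi> (frac_rel W `` {(A, B)}) = frac (A \<circ> \<Phi>) (B \<circ> \<Phi>)"
  proof (rule subset_antisym)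
    show "pullback V \<Phi> (frac_rel W `` {(A, B)}) \<subseteq> frac (A \<circ> \<Phi>) (B \<circ> \<Phi>)"
    proof
      fix x assume "x \<in> pullback V \<Phi> (frac_rel W `` {(A, B)})"
      then obtain A' B' where *: "((A, B), (A', B')) \<in> frac_rel W" "x \<in> frac (A' \<circ> \<Phi>) (B' \<circ> \<Phi>)"
        unfolding pullback_def by auto
      then show "x \<in> frac (A \<circ> \<Phi>) (B \<circ> \<Phi>)" using same[OF *(1)] empty[of B' A'] by blast
    qed
    show "frac (A \<circ> \<Phi>) (B \<circ> \<Phi>) \<subseteq> pullback V \<Phi> (frac_rel W `` {(A, B)})"
      unfolding pullback_def using self by auto
  qed
qed

lemma pullback_dominant:
  assumes "dominant \<Phi>" "(A, B) \<in> fractions V"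
  shows "pullback V \<Phi> (frac A B) = frac (A \<circ> \<Phi>) (B \<circ> \<Phi>)" "(A \<circ> \<Phi>, B \<circ> \<Phi>) \<in> fractions V"
proof -
  obtain d where d: "\<And>i. form d (\<lambda>v. \<Phi> v $ i)" "\<And>v. v \<in> V \<Longrightarrow> \<Phi> v \<noteq> 0 \<Longrightarrow> \<Phi> v \<in> V"
    using dominantD(1)[OF assms(1)] by (rule rational_mapE) blast
  have B: "\<exists>v\<in>V. B (\<Phi> v) \<noteq> 0"
    using assms(2) by (rule fractionsE) (rule dominantD(2)[OF assms(1)])
  show "pullback V \<Phi> (frac A B) = frac (A \<circ> \<Phi>) (B \<circ> \<Phi>)"
    by (rule pullback_frac(1)[OF d(1) _ assms(2) B]) (rule d(2))
  show "(A \<circ> \<Phi>, B \<circ> \<Phi>) \<in> fractions V"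
    by (rule pullback_frac(2)[OF d(1) _ assms(2) B]) (rule d(2))
qed

text \<open>
  The geometric side and the Galois side meet here: a birational map and an automorphism can be
  compared as endomorphisms of the function field.
\<close>

lemma pullback_ring_hom:
  assumes "dominant \<Phi>"
  shows "pullback V \<Phi> \<in> ring_hom L L"
proof (rule ring_hom_memI)
  note pb = pullback_dominant[OF assms]
  fix x y
  assume "x \<in> carrier L"
  then obtain A B where x: "(A, B) \<in> fractions V" "x = frac A B" by (rule carrierE)
  show "pullback V \<Phi> x \<in> carrier L" by (simp add: x pb frac_closed)
  assume "y \<in> carrier L"
  then obtain C D where y: "(C, D) \<in> fractions V" "y = frac C D" by (rule carrierE)
  show "pullback V \<Phi> (x \<otimes>\<^bsub>L\<^esub> y) = pullback V \<Phi> x \<otimes>\<^bsub>L\<^esub> pullback V \<Phi> y"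
    using pb[OF fractions_mult[OF x(1) y(1)]] by (simp add: x y frac_mult pb) (simp add: comp_def)
  show "pullback V \<Phi> (x \<oplus>\<^bsub>L\<^esub> y) = pullback V \<Phi> x \<oplus>\<^bsub>L\<^esub> pullback V \<Phi> y"
    using pb[OF fractions_add[OF x(1) y(1)]] by (simp add: x y frac_add pb) (simp add: comp_def)
next
  show "pullback V \<Phi> \<one>\<^bsub>L\<^esub> = \<one>\<^bsub>L\<^esub>"
    using pullback_dominant[OF assms fractions_const, of 1] by (simp add: one_frac comp_def)
qed

end

section \<open>Quartics that are graphs\<close>

text \<open>In the affine chart \<open>Y = 1\<close> this is the graph of \<open>z = a x\<^sup>4 + b x\<^sup>3\<close>.\<close>

definition graph_quartic :: "complex \<Rightarrow> complex \<Rightarrow> complex ^ 3 \<Rightarrow> complex" where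
  "graph_quartic a b v = (v $ 2) ^ 3 * v $ 3 - a * (v $ 1) ^ 4 - b * (v $ 1) ^ 3 * v $ 2"

text \<open>
  The homogeneous form of the polynomial automorphism \<open>(x, z) \<mapsto> (x, z + a x\<^sup>4 + b x\<^sup>3)\<close> of the
  chart \<open>Y = 1\<close>, which carries the line \<open>z = 0\<close> to the graph.
\<close>

definition shear :: "complex \<Rightarrow> complex \<Rightarrow> complex ^ 3 \<Rightarrow> complex ^ 3" where
  "shear a b v = vector [v $ 1 * (v $ 2) ^ 3, (v $ 2) ^ 4,
     v $ 3 * (v $ 2) ^ 3 + a * (v $ 1) ^ 4 + b * (v $ 1) ^ 3 * v $ 2]"

definition affine_matrix :: "complex \<Rightarrow> complex \<Rightarrow> complex ^ 3 ^ 3" where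
  "affine_matrix c e = vector [vector [c, e, 0], vector [0, 1, 0], vector [0, 0, 1]]"

lemma affine_matrix_mult: "affine_matrix c e *v v = vector [c * v $ 1 + e * v $ 2, v $ 2, v $ 3]"
  by (simp add: affine_matrix_def vec_eq_iff forall_3 matrix_vector_mult_def sum_3 vector_3)

lemma form_vector_3:
  assumes "form d A" "form d B" "form d C"
  shows "form d (\<lambda>v. (vector [A v, B v, C v] :: complex ^ 3) $ i)"
  using assms exhaust_3[of i] by (auto simp: vector_3)

lemma form_linear:
  fixes M :: "complex ^ 'n ^ 'm"
  shows "form 1 (\<lambda>v. (M *v v) $ i)"
  unfolding matrix_vector_mult_def vec_lambda_beta by (intro form_sum form_scale form_coord)

lemma form_shear: "form 4 (\<lambda>v. shear a b v $ i)"
proof -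
  have "form (1 + 3) (\<lambda>v :: complex ^ 3. v $ 1 * (v $ 2) ^ 3)"
    and "form (1 + 3) (\<lambda>v :: complex ^ 3. v $ 3 * (v $ 2) ^ 3)"
    and "form (3 + 1) (\<lambda>v :: complex ^ 3. b * (v $ 1) ^ 3 * v $ 2)"
    by (intro form_mult form_scale form_coord form_coord_power)+
  then show ?thesis
    unfolding shear_def
    by (intro form_vector_3 form_add) (simp_all add: form_coord_power form_scale)
qed

lemma form_graph_quartic: "form 4 (graph_quartic a b)"
proof -
  have "form (3 + 1) (\<lambda>v :: complex ^ 3. (v $ 2) ^ 3 * v $ 3)"
    and "form (3 + 1) (\<lambda>v :: complex ^ 3. b * (v $ 1) ^ 3 * v $ 2)"
    by (intro form_mult form_scale form_coord form_coord_power)+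
  then have "form 4 (\<lambda>v :: complex ^ 3. (v $ 2) ^ 3 * v $ 3 - a * (v $ 1) ^ 4 - b * (v $ 1) ^ 3 * v $ 2)"
    by (intro form_diff) (simp_all add: form_coord_power form_scale)
  then show ?thesis by (simp add: graph_quartic_def[abs_def])
qed

lemma irreducible_P2: "irreducible_cone P2"
proof (rule irreducible_coneI)
  show "P2 \<noteq> {}" unfolding proj_space_def using zero_neq_one by blast
  fix v w :: "complex ^ 3"
  let ?\<gamma> = "\<lambda>i. [:v $ i, w $ i - v $ i:]"
  show "\<exists>\<gamma> a b. a \<noteq> 0 \<and> b \<noteq> 0 \<and> (\<chi> i. poly (\<gamma> i) 0) = a *s v \<and> (\<chi> i. poly (\<gamma> i) 1) = b *s w \<and>
      (\<forall>t. (\<chi> i. poly (\<gamma> i) t) \<noteq> 0 \<longrightarrow> (\<chi> i. poly (\<gamma> i) t) \<in> P2)"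
    by (rule exI[of _ ?\<gamma>], rule exI[of _ 1], rule exI[of _ 1]) (simp add: vec_eq_iff proj_space_def)
qed (auto simp: proj_space_def)

text \<open>
  Over the projective line with coordinates \<open>(s : t)\<close> the quartic is parametrized by
  \<open>(s t\<^sup>3 : t\<^sup>4 : a s\<^sup>4 + b s\<^sup>3 t)\<close>; the image of a line of parameters joins two given points.
  For \<open>a = 0\<close> the curve would contain the line \<open>Y = 0\<close>.
\<close>

lemma irreducible_graph_quartic:
  assumes "a \<noteq> 0"
  shows "irreducible_cone (curve (graph_quartic a b))"
proof (rule irreducible_coneI)
  show "curve (graph_quartic a b) \<noteq> {}"
    unfolding curve_def proj_space_def graph_quartic_def
    by (auto simp: vec_eq_iff forall_3 vector_3 intro!: exI[of _ "vector [0, 1, 0]"])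
  show "0 \<notin> curve (graph_quartic a b)" unfolding curve_def proj_space_def by simp
  show "c *s v \<in> curve (graph_quartic a b)" if "v \<in> curve (graph_quartic a b)" "c \<noteq> 0" for v c
    using that form_homogeneous[OF form_graph_quartic] unfolding curve_def proj_space_def by auto
  have param: "\<exists>s t c. c \<noteq> 0 \<and> vector [s * t ^ 3, t ^ 4, a * s ^ 4 + b * s ^ 3 * t] = c *s v"
    if "v \<in> curve (graph_quartic a b)" for v
  proof (cases "v $ 2 = 0")
    case False
    have "vector [v $ 1 * (v $ 2) ^ 3, (v $ 2) ^ 4, a * (v $ 1) ^ 4 + b * (v $ 1) ^ 3 * v $ 2] = (v $ 2) ^ 3 *s v"
      using that unfolding curve_def graph_quartic_def
      by (simp add: vec_eq_iff forall_3 vector_3 algebra_simps power_numeral_reduce)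
    then show ?thesis using False by (metis power_not_zero)
  next
    case True
    have "v $ 1 = 0" "v $ 3 \<noteq> 0"
      using that True assms unfolding curve_def graph_quartic_def proj_space_def
      by (auto simp: vec_eq_iff forall_3)
    then have "vector [1 * 0 ^ 3, 0 ^ 4, a * 1 ^ 4 + b * 1 ^ 3 * 0] = (a / v $ 3) *s v"
      using True by (simp add: vec_eq_iff forall_3 vector_3)
    moreover have "a / v $ 3 \<noteq> 0" using assms \<open>v $ 3 \<noteq> 0\<close> by simp
    ultimately show ?thesis by blast
  qed
  fix v w
  assume "v \<in> curve (graph_quartic a b)" "w \<in> curve (graph_quartic a b)"
  then obtain s t c s' t' c' where c: "c \<noteq> 0" "c' \<noteq> 0"
    and v: "vector [s * t ^ 3, t ^ 4, a * s ^ 4 + b * s ^ 3 * t] = c *s v"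
    and w: "vector [s' * t' ^ 3, t' ^ 4, a * s' ^ 4 + b * s' ^ 3 * t'] = c' *s w"
    using param by meson
  let ?s = "[:s, s' - s:]" and ?t = "[:t, t' - t:]"
  define \<gamma> :: "3 \<Rightarrow> complex poly"
    where "\<gamma> = vec_nth (vector [?s * ?t ^ 3, ?t ^ 4, [:a:] * ?s ^ 4 + [:b:] * ?s ^ 3 * ?t])"
  have \<gamma>: "(\<chi> i. poly (\<gamma> i) x) = vector [poly ?s x * poly ?t x ^ 3, poly ?t x ^ 4,
      a * poly ?s x ^ 4 + b * poly ?s x ^ 3 * poly ?t x]" for x
    by (simp add: \<gamma>_def vec_eq_iff forall_3 vector_3 poly_power ring_distribs)
  have "(\<chi> i. poly (\<gamma> i) 0) = c *s v" "(\<chi> i. poly (\<gamma> i) 1) = c' *s w"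
    unfolding \<gamma> v[symmetric] w[symmetric] by simp_all
  moreover have "graph_quartic a b (\<chi> i. poly (\<gamma> i) x) = 0" for x
  proof -
    have "graph_quartic a b (vector [s * t ^ 3, t ^ 4, a * s ^ 4 + b * s ^ 3 * t]) = 0" for s t
      by (simp add: graph_quartic_def vector_3 algebra_simps power_numeral_reduce)
    then show ?thesis unfolding \<gamma> .
  qed
  then have "\<forall>x. (\<chi> i. poly (\<gamma> i) x) \<noteq> 0 \<longrightarrow> (\<chi> i. poly (\<gamma> i) x) \<in> curve (graph_quartic a b)"
    unfolding curve_def proj_space_def by simp
  ultimately show "\<exists>\<gamma> a' b'. a' \<noteq> 0 \<and> b' \<noteq> 0 \<and> (\<chi> i. poly (\<gamma> i) 0) = a' *s v \<and> (\<chi> i. poly (\<gamma> i) 1) = b' *s w \<and>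
      (\<forall>x. (\<chi> i. poly (\<gamma> i) x) \<noteq> 0 \<longrightarrow> (\<chi> i. poly (\<gamma> i) x) \<in> curve (graph_quartic a b))"
    using c by blast
qed

lemma cubic_splits:
  obtains c :: complex where "c ^ 3 = 1" "\<And>x y. (x - y) * ((x - c * y) * (x - c\<^sup>2 * y)) = x ^ 3 - y ^ 3"
proof -
  define c where "c = Complex (- 1 / 2) (sqrt 3 / 2)"
  have c: "c\<^sup>2 + c + 1 = 0"
    by (simp add: c_def complex_eq_iff power2_eq_square)
  have "c ^ 3 - 1 = (c - 1) * (c\<^sup>2 + c + 1)"
    by (simp add: algebra_simps power2_eq_square power3_eq_cube)
  then have c3: "c ^ 3 = 1" by (simp add: c)
  have "(x - y) * ((x - c * y) * (x - c\<^sup>2 * y)) = x ^ 3 - y ^ 3" for x y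
  proof -
    have "(x - y) * ((x - c * y) * (x - c\<^sup>2 * y))
        = x ^ 3 - (c\<^sup>2 + c + 1) * (x\<^sup>2 * y) + c * (c\<^sup>2 + c + 1) * (x * y\<^sup>2) - c ^ 3 * y ^ 3"
      by (simp add: algebra_simps power2_eq_square power3_eq_cube)
    then show ?thesis by (simp add: c c3)
  qed
  with c3 show ?thesis by (rule that)
qed

section \<open>The function field of a graph quartic\<close>

locale graph_quartic_curve =
  fixes a b :: complex
  assumes a: "a \<noteq> 0"
begin

abbreviation C :: "(complex ^ 3) set" where "C \<equiv> curve (graph_quartic a b)"

sublocale irreducible_cone C
  by (rule irreducible_graph_quartic[OF a])

lemma on_C: "v \<in> C \<Longrightarrow> (v $ 2) ^ 3 * v $ 3 = a * (v $ 1) ^ 4 + b * (v $ 1) ^ 3 * v $ 2"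
  unfolding curve_def graph_quartic_def by (simp add: algebra_simps)

lemma flex_on_C: "vector [0, 1, 0] \<in> C"
  unfolding curve_def proj_space_def graph_quartic_def by (auto simp: vec_eq_iff forall_3 vector_3)

lemma fractions_over_Y: "form d A \<Longrightarrow> (A, \<lambda>v. (v $ 2) ^ d) \<in> fractions C"
  using flex_on_C by (intro fractionsI[OF _ form_coord_power]) (auto intro!: bexI[of _ "vector [0, 1, 0]"] simp: vector_3)

lemma fractions_over_Y_1: "form 1 A \<Longrightarrow> (A, \<lambda>v. v $ 2) \<in> fractions C"
  using fractions_over_Y[of 1 A] by simp

text \<open>
  The curve is rational with coordinate \<open>u = X/Y\<close>: the other affine coordinate is
  \<open>Z/Y = a u\<^sup>4 + b u\<^sup>3\<close>. So an endomorphism of the function field over the constants is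
  determined by the image of \<open>u\<close>.
\<close>

lemma ring_homs_eqI:
  assumes field: "field L" and hom: "h \<in> ring_hom L L" "k \<in> ring_hom L L"
    and const: "\<And>c. h (frac (\<lambda>v. c) (\<lambda>v. 1)) = k (frac (\<lambda>v. c) (\<lambda>v. 1))"
    and coord: "h (frac (\<lambda>v. v $ 1) (\<lambda>v. v $ 2)) = k (frac (\<lambda>v. v $ 1) (\<lambda>v. v $ 2))"
    and x: "x \<in> carrier L"
  shows "h x = k x"
proof -
  interpret L: field L by (rule field)
  note [simp] = ring_hom_mult[OF hom(1)] ring_hom_mult[OF hom(2)] ring_hom_add[OF hom(1)] ring_hom_add[OF hom(2)]
  define agree where "agree A B \<longleftrightarrow> (A, B) \<in> fractions C \<and> h (frac A B) = k (frac A B)" for A B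
  have agree_fractions: "agree A B \<Longrightarrow> (A, B) \<in> fractions C" for A B unfolding agree_def by simp
  have agree_mult: "agree (\<lambda>v. A v * A' v) (\<lambda>v. B v * B' v)" if "agree A B" "agree A' B'" for A B A' B'
  proof -
    have "h (frac A B \<otimes>\<^bsub>L\<^esub> frac A' B') = k (frac A B \<otimes>\<^bsub>L\<^esub> frac A' B')"
      using that by (simp add: agree_def frac_closed)
    then show ?thesis using that by (simp add: agree_def frac_mult fractions_mult)
  qed
  have agree_add: "agree (\<lambda>v. A v * B' v + A' v * B v) (\<lambda>v. B v * B' v)" if "agree A B" "agree A' B'" for A B A' B'
  proof -
    have "h (frac A B \<oplus>\<^bsub>L\<^esub> frac A' B') = k (frac A B \<oplus>\<^bsub>L\<^esub> frac A' B')"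
      using that by (simp add: agree_def frac_closed)
    then show ?thesis using that by (simp add: agree_def frac_add fractions_add)
  qed
  have agree_cong: "agree A' B'"
    if "agree A B" "(A', B') \<in> fractions C" "\<And>v. v \<in> C \<Longrightarrow> A' v * B v = A v * B' v" for A B A' B'
    using that frac_eq[of A' B' A B] unfolding agree_def by simp
  have agree_const: "agree (\<lambda>v. c) (\<lambda>v. 1)" for c
    unfolding agree_def using const fractions_const by simp
  have agree_power: "agree (\<lambda>v. A v ^ n) (\<lambda>v. B v ^ n)" if "agree A B" for A B n
    by (induction n) (use agree_const[of 1] agree_mult[OF that] in simp_all)
  have X: "agree (\<lambda>v. v $ 1) (\<lambda>v. v $ 2)"
    unfolding agree_def using coord fractions_over_Y_1[OF form_coord] by blast
  have Y: "agree (\<lambda>v. v $ 2) (\<lambda>v. v $ 2)"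
    by (rule agree_cong[OF agree_const[of 1]]) (auto intro: fractions_over_Y_1[OF form_coord])
  have Z: "agree (\<lambda>v. v $ 3) (\<lambda>v. v $ 2)"
  proof (rule agree_cong)
    show "agree (\<lambda>v. (a * v $ 1 ^ 4) * (1 * v $ 2 ^ 3) + (b * v $ 1 ^ 3) * (1 * v $ 2 ^ 4))
        (\<lambda>v. (1 * v $ 2 ^ 4) * (1 * v $ 2 ^ 3))"
      by (intro agree_add agree_mult agree_const agree_power X)
    fix v assume "v \<in> C"
    have "v $ 3 * ((1 * v $ 2 ^ 4) * (1 * v $ 2 ^ 3)) = ((v $ 2) ^ 3 * v $ 3) * (v $ 2) ^ 4"
      by simp
    also have "\<dots> = (a * (v $ 1) ^ 4 + b * (v $ 1) ^ 3 * v $ 2) * (v $ 2) ^ 4"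
      unfolding on_C[OF \<open>v \<in> C\<close>] ..
    also have "\<dots> = ((a * v $ 1 ^ 4) * (1 * v $ 2 ^ 3) + (b * v $ 1 ^ 3) * (1 * v $ 2 ^ 4)) * v $ 2"
      by (simp add: algebra_simps power_numeral_reduce)
    finally show "v $ 3 * ((1 * v $ 2 ^ 4) * (1 * v $ 2 ^ 3))
        = ((a * v $ 1 ^ 4) * (1 * v $ 2 ^ 3) + (b * v $ 1 ^ 3) * (1 * v $ 2 ^ 4)) * v $ 2" .
  qed (rule fractions_over_Y_1[OF form_coord])
  have monomial: "agree (\<lambda>v. c * (\<Prod>i\<in>UNIV. (v $ i) ^ \<alpha> i)) (\<lambda>v. (v $ 2) ^ sum \<alpha> UNIV)" for c and \<alpha> :: "3 \<Rightarrow> nat"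
  proof (rule agree_cong)
    show "agree (\<lambda>v. c * ((v $ 1) ^ \<alpha> 1 * ((v $ 2) ^ \<alpha> 2 * (v $ 3) ^ \<alpha> 3)))
        (\<lambda>v. 1 * ((v $ 2) ^ \<alpha> 1 * ((v $ 2) ^ \<alpha> 2 * (v $ 2) ^ \<alpha> 3)))"
      by (intro agree_mult agree_const agree_power X Y Z)
    show "(\<lambda>v. c * (\<Prod>i\<in>UNIV. (v $ i) ^ \<alpha> i), \<lambda>v. (v $ 2) ^ sum \<alpha> UNIV) \<in> fractions C"
      by (intro fractions_over_Y form_monomial)
    have "(\<Prod>i\<in>UNIV. f i) = f 1 * f 2 * f 3" for f :: "3 \<Rightarrow> complex"
      unfolding UNIV_3 by (simp add: mult.assoc)
    then show "c * (\<Prod>i\<in>UNIV. (v $ i) ^ \<alpha> i) * (1 * ((v $ 2) ^ \<alpha> 1 * ((v $ 2) ^ \<alpha> 2 * (v $ 2) ^ \<alpha> 3)))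
        = c * ((v $ 1) ^ \<alpha> 1 * ((v $ 2) ^ \<alpha> 2 * (v $ 3) ^ \<alpha> 3)) * (v $ 2) ^ sum \<alpha> UNIV" for v :: "complex ^ 3"
      by (simp add: sum_3 power_add mult_ac)
  qed
  have polynomial: "agree (\<lambda>v. \<Sum>\<alpha>\<in>S. c \<alpha> * (\<Prod>i\<in>UNIV. (v $ i) ^ \<alpha> i)) (\<lambda>v. (v $ 2) ^ d)"
    if "finite S" "S \<subseteq> {\<alpha>. sum \<alpha> UNIV = d}" for S d and c :: "(3 \<Rightarrow> nat) \<Rightarrow> complex"
    using that
  proof (induction S rule: finite_induct)
    case empty
    show ?case
      by (rule agree_cong[OF agree_const[of 0]]) (auto intro: fractions_over_Y form_zero)
  next
    case (insert \<alpha> S)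
    let ?M = "\<lambda>v. c \<alpha> * (\<Prod>i\<in>UNIV. (v $ i) ^ \<alpha> i)" and ?R = "\<lambda>v. \<Sum>\<alpha>\<in>S. c \<alpha> * (\<Prod>i\<in>UNIV. (v $ i) ^ \<alpha> i)"
    have \<alpha>: "d = sum \<alpha> UNIV" using insert by auto
    have "agree (\<lambda>v. ?M v * (v $ 2) ^ d + ?R v * (v $ 2) ^ d) (\<lambda>v. (v $ 2) ^ d * (v $ 2) ^ d)"
      using insert monomial[of "c \<alpha>" \<alpha>] unfolding \<alpha> by (intro agree_add) auto
    moreover have "form d (\<lambda>v. \<Sum>\<alpha>\<in>insert \<alpha> S. c \<alpha> * (\<Prod>i\<in>UNIV. (v $ i) ^ \<alpha> i))"
      using insert.prems form_monomial by (intro form_sum) blast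
    ultimately show ?case
      by (rule agree_cong[OF _ fractions_over_Y]) (use insert in \<open>simp add: algebra_simps\<close>)
  qed
  have over_Y: "agree A (\<lambda>v. (v $ 2) ^ d)" if A: "form d A" for A d
  proof -
    obtain c where "A = (\<lambda>v. \<Sum>\<alpha> | sum \<alpha> UNIV = d. c \<alpha> * (\<Prod>i\<in>UNIV. (v $ i) ^ \<alpha> i))"
      using A unfolding form_def by blast
    then show ?thesis using polynomial[OF finite_exponents subset_refl] by simp
  qed
  obtain d A B where AB: "form d A" "form d B" "\<exists>v\<in>C. B v \<noteq> 0" "(A, B) \<in> fractions C" "x = frac A B"
    using x by (rule carrierE)
  let ?y = "frac B (\<lambda>v. (v $ 2) ^ d)" and ?z = "frac A (\<lambda>v. (v $ 2) ^ d)"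
  note Y_fractions = fractions_over_Y[OF AB(1)] fractions_over_Y[OF AB(2)]
  have "x \<otimes>\<^bsub>L\<^esub> ?y = ?z"
    unfolding AB(5) frac_mult[OF AB(4) Y_fractions(2)]
    by (rule frac_eq[OF fractions_mult[OF AB(4) Y_fractions(2)] Y_fractions(1)]) simp
  moreover have "h ?z = k ?z" and hk: "h ?y = k ?y"
    using over_Y[OF AB(1)] over_Y[OF AB(2)] unfolding agree_def by blast+
  ultimately have "h (x \<otimes>\<^bsub>L\<^esub> ?y) = k (x \<otimes>\<^bsub>L\<^esub> ?y)" by simp
  then have eq: "h x \<otimes>\<^bsub>L\<^esub> h ?y = k x \<otimes>\<^bsub>L\<^esub> h ?y"
    using x frac_closed[OF Y_fractions(2)] by (simp add: hk)
  moreover have "h ?y \<noteq> \<zero>\<^bsub>L\<^esub>"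
  proof -
    have "?y \<noteq> \<zero>\<^bsub>L\<^esub>"
      using frac_eqD[OF _ Y_fractions(2) fractions_const[of 0]] AB(3) by (auto simp: zero_frac)
    then have "?y \<in> Units L" using frac_closed[OF Y_fractions(2)] by (simp add: L.field_Units)
    then have "h ?y \<otimes>\<^bsub>L\<^esub> h (inv\<^bsub>L\<^esub> ?y) = \<one>\<^bsub>L\<^esub>" "h (inv\<^bsub>L\<^esub> ?y) \<in> carrier L"
      using ring_hom_mult[OF hom(1), of ?y "inv\<^bsub>L\<^esub> ?y"] ring_hom_one[OF hom(1)] ring_hom_closed[OF hom(1)]
      by (simp_all add: L.Units_closed)
    then show ?thesis using L.l_null L.zero_not_one by metis
  qed
  ultimately show "h x = k x"
    using L.m_rcancel[of "h ?y" "h x" "k x"] x frac_closed[OF Y_fractions(2)]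
      ring_hom_closed[OF hom(1)] ring_hom_closed[OF hom(2)] by simp
qed

text \<open>
  A ratio \<open>A/B\<close> of forms in the coordinates of the projection defines an element of the
  subfield as soon as its denominator does not pull back to zero.
\<close>

lemma mem_K_at:
  fixes M :: "complex ^ 3 ^ 2"
  assumes M: "{v. M *v v = 0} = range (\<lambda>c. c *s P)"
    and AB: "form d A" "form d B" and B: "\<exists>v\<in>C. B (M *v v) \<noteq> 0"
  shows "frac (\<lambda>v. A (M *v v)) (\<lambda>v. B (M *v v)) \<in> K_at C P"
    "(\<lambda>v. A (M *v v), \<lambda>v. B (M *v v)) \<in> fractions C"
proof -
  have nz: "\<exists>w\<in>P1. B w \<noteq> 0"
  proof (cases "d = 0")
    case True
    obtain v where "B (M *v v) \<noteq> 0" using B by blast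
    then have "B 1 \<noteq> 0" using True AB(2) form_0_const[of B 1 "M *v v"] by simp
    then show ?thesis unfolding proj_space_def mem_Collect_eq by (intro bexI[where x = 1]) auto
  next
    case False
    then have "B 0 = 0" using form_at_zero[OF AB(2)] by simp
    moreover obtain v where "B (M *v v) \<noteq> 0" using B by blast
    ultimately show ?thesis unfolding proj_space_def mem_Collect_eq by (intro bexI[where x = "M *v v"]) auto
  qed
  have AB': "(A, B) \<in> fractions P1" using AB nz unfolding fractions_def by blast
  note pb = pullback_frac[where \<Phi> = "\<lambda>v. M *v v" and W = P1, OF form_linear _ AB' B]
  have "frac (A \<circ> (\<lambda>v. M *v v)) (B \<circ> (\<lambda>v. M *v v)) = pullback C (\<lambda>v. M *v v) (frac_rel P1 `` {(A, B)})"
    using pb(1) by (simp add: proj_space_def)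
  moreover have "projection_from P (\<lambda>v. M *v v)" unfolding projection_from_def using M by blast
  moreover have "frac_rel P1 `` {(A, B)} \<in> carrier (function_field P1)"
    using AB' unfolding function_field_def by (simp add: quotientI)
  ultimately show "frac (\<lambda>v. A (M *v v)) (\<lambda>v. B (M *v v)) \<in> K_at C P"
    unfolding K_at_def mem_Collect_eq comp_def by (intro exI conjI)
  show "(\<lambda>v. A (M *v v), \<lambda>v. B (M *v v)) \<in> fractions C"
    using pb(2) by (simp add: proj_space_def comp_def)
qed

text \<open>
  The hypothesis \<open>cube\<close> says that \<open>A/B\<close> pulls back to \<open>(u - e)\<^sup>3\<close> for \<open>u = X/Y\<close>. So \<open>\<sigma>\<close> fixes
  this cube, and since \<open>T\<^sup>3 - (u - e)\<^sup>3\<close> splits into linear factors, \<open>\<sigma>\<close> multiplies \<open>u - e\<close> by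
  a third root of unity \<open>c\<close>: in the coordinate \<open>u\<close> it is the affine map with fixed point \<open>e\<close>.
\<close>

lemma galois_image:
  fixes M :: "complex ^ 3 ^ 2"
  assumes gal: "galois_point C P" and \<sigma>: "\<sigma> \<in> carrier (G_at C P)"
    and M: "{v. M *v v = 0} = range (\<lambda>c. c *s P)"
    and AB: "form d A" "form d B" "\<exists>v\<in>C. B (M *v v) \<noteq> 0"
    and cube: "\<And>v. v \<in> C \<Longrightarrow> A (M *v v) * (v $ 2) ^ 3 = (v $ 1 - e * v $ 2) ^ 3 * B (M *v v)"
  obtains c where "c ^ 3 = 1" "field L" "\<sigma> \<in> ring_hom L L"
    "\<And>k. \<sigma> (frac (\<lambda>v. k) (\<lambda>v. 1)) = frac (\<lambda>v. k) (\<lambda>v. 1)"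
    "\<sigma> (frac (\<lambda>v. v $ 1) (\<lambda>v. v $ 2)) = frac (\<lambda>v. c * v $ 1 + (1 - c) * e * v $ 2) (\<lambda>v. v $ 2)"
proof -
  have field: "field L" using gal unfolding galois_point_def galois_extension_def by blast
  interpret L: field L by (rule field)
  have hom: "\<sigma> \<in> ring_hom L L" and fixes_K: "\<And>x. x \<in> K_at C P \<Longrightarrow> \<sigma> x = x"
    using \<sigma> unfolding G_at_def galois_group_def by auto
  \<comment> \<open>Constants are pulled back from the projective line.\<close>
  have const: "\<sigma> (frac (\<lambda>v. k) (\<lambda>v. 1)) = frac (\<lambda>v. k) (\<lambda>v. 1)" for k
    using mem_K_at[OF M form_const form_const, of 1 k] nonempty fixes_K by auto
  let ?X = "\<lambda>v :: complex ^ 3. v $ 1" and ?Y = "\<lambda>v :: complex ^ 3. v $ 2"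
  let ?W = "\<lambda>v :: complex ^ 3. v $ 1 - e * v $ 2"
  have form_W: "form 1 ?W" by (intro form_diff form_scale form_coord)
  note WY = fractions_over_Y_1[OF form_W] and XY = fractions_over_Y_1[OF form_coord[of 1]]
  define w where "w = frac ?W ?Y"
  have w: "w \<in> carrier L" unfolding w_def by (rule frac_closed[OF WY])
  have WY2: "(\<lambda>v. ?W v * ?W v, \<lambda>v. ?Y v * ?Y v) \<in> fractions C" by (intro fractions_mult WY)
  have w3: "w \<otimes>\<^bsub>L\<^esub> (w \<otimes>\<^bsub>L\<^esub> w) = frac (\<lambda>v. ?W v * (?W v * ?W v)) (\<lambda>v. ?Y v * (?Y v * ?Y v))"
    unfolding w_def by (simp add: frac_mult WY WY2)
  also have "\<dots> = frac (\<lambda>v. A (M *v v)) (\<lambda>v. B (M *v v))"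
    by (rule frac_eq[OF fractions_mult[OF WY WY2] mem_K_at(2)[OF M AB]])
      (use cube in \<open>simp add: power3_eq_cube mult_ac\<close>)
  finally have fixed: "\<sigma> (w \<otimes>\<^bsub>L\<^esub> (w \<otimes>\<^bsub>L\<^esub> w)) = w \<otimes>\<^bsub>L\<^esub> (w \<otimes>\<^bsub>L\<^esub> w)"
    using fixes_K mem_K_at(1)[OF M AB] by simp
  obtain f R S where RS: "form f R" "form f S" "\<exists>v\<in>C. S v \<noteq> 0" "(R, S) \<in> fractions C" "\<sigma> w = frac R S"
    using ring_hom_closed[OF hom w] by (rule carrierE)
  note RS2 = fractions_mult[OF RS(4) RS(4)]
  have "frac (\<lambda>v. R v * (R v * R v)) (\<lambda>v. S v * (S v * S v))
      = frac (\<lambda>v. ?W v * (?W v * ?W v)) (\<lambda>v. ?Y v * (?Y v * ?Y v))"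
    using fixed unfolding w3[symmetric]
    by (simp add: ring_hom_mult[OF hom] w RS(5) frac_mult RS(4) RS2)
  then have cubes: "(R v * v $ 2) ^ 3 = (?W v * S v) ^ 3" if "v \<in> C" for v
    using frac_eqD[OF _ fractions_mult[OF RS(4) RS2] fractions_mult[OF WY WY2] that]
    by (simp add: power3_eq_cube mult_ac)
  obtain z :: complex where z: "z ^ 3 = 1" "\<And>x y. (x - y) * ((x - z * y) * (x - z\<^sup>2 * y)) = x ^ 3 - y ^ 3"
    using cubic_splits by blast
  \<comment> \<open>\<open>D c\<close> is the numerator of \<open>\<sigma> w - c w\<close>; one of the three must vanish on the curve.\<close>
  define D where "D c v = R v * v $ 2 - c * (?W v * S v)" for c v
  have form_D: "form (f + 1) (D c)" for c
  proof -
    have "form (f + 1) (\<lambda>v. R v * v $ 2)" by (intro form_mult RS form_coord)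
    moreover have "form (f + 1) (\<lambda>v. ?W v * S v)" using form_mult[OF form_W RS(2)] by (simp add: add.commute)
    ultimately show ?thesis unfolding D_def[abs_def] by (intro form_diff form_scale)
  qed
  have "\<forall>v\<in>C. D 1 v * (D z v * D (z\<^sup>2) v) = 0"
    using cubes by (simp add: D_def z(2)) 
  from irreducible[OF form_D form_mult[OF form_D form_D] this]
  have "(\<forall>v\<in>C. D 1 v = 0) \<or> (\<forall>v\<in>C. D z v = 0) \<or> (\<forall>v\<in>C. D (z\<^sup>2) v = 0)"
    using irreducible[OF form_D form_D, of z "z\<^sup>2"] by blast
  then obtain c where c: "c \<in> {1, z, z\<^sup>2}" "\<And>v. v \<in> C \<Longrightarrow> D c v = 0" by blast
  have "(z\<^sup>2) ^ 3 = (z ^ 3)\<^sup>2" by (simp add: power_mult[symmetric])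
  then have c3: "c ^ 3 = 1" using c(1) z(1) by auto
  have cWY: "(\<lambda>v. c * ?W v, ?Y) \<in> fractions C" by (intro fractions_over_Y_1 form_scale form_W)
  have \<sigma>w: "\<sigma> w = frac (\<lambda>v. c * ?W v) ?Y"
    unfolding RS(5) by (rule frac_eq[OF RS(4) cWY]) (use c(2) in \<open>simp add: D_def mult.assoc\<close>)
  let ?e = "frac (\<lambda>v. e) (\<lambda>v. 1)"
  have "frac ?X ?Y = w \<oplus>\<^bsub>L\<^esub> ?e"
    unfolding w_def frac_add[OF WY fractions_const]
    by (rule frac_eq[OF XY fractions_add[OF WY fractions_const]]) (simp add: algebra_simps)
  then have "\<sigma> (frac ?X ?Y) = frac (\<lambda>v. c * ?W v) ?Y \<oplus>\<^bsub>L\<^esub> ?e"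
    by (simp add: ring_hom_add[OF hom w frac_closed[OF fractions_const]] \<sigma>w const)
  also have "\<dots> = frac (\<lambda>v. c * v $ 1 + (1 - c) * e * v $ 2) ?Y"
    unfolding frac_add[OF cWY fractions_const]
    by (rule frac_eq[OF fractions_add[OF cWY fractions_const] fractions_over_Y_1[OF form_add[OF form_scale form_scale]]])
      (simp_all only: form_coord, simp add: algebra_simps)
  finally show ?thesis using that c3 field hom const by blast
qed

text \<open>
  Since both are determined by the image of \<open>u\<close>, a birational map induces \<open>\<sigma>\<close> once its first
  affine coordinate is \<open>\<sigma> u\<close>.
\<close>

lemma mem_birational_ofI:
  assumes "field L" "\<sigma> \<in> ring_hom L L" and const: "\<And>k. \<sigma> (frac (\<lambda>v. k) (\<lambda>v. 1)) = frac (\<lambda>v. k) (\<lambda>v. 1)"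
    and \<sigma>: "\<sigma> (frac (\<lambda>v. v $ 1) (\<lambda>v. v $ 2)) = frac A (\<lambda>v. v $ 2)" and A: "form 1 A"
    and \<Phi>: "birational C \<Phi>" "\<And>v. v \<in> C \<Longrightarrow> \<Phi> v $ 1 * v $ 2 = A v * \<Phi> v $ 2"
  shows "\<Phi> \<in> birational_of C \<sigma>"
proof -
  note dom = birational_imp_dominant[OF \<Phi>(1)]
  note pb = pullback_dominant[OF dom]
  note XY = fractions_over_Y_1[OF form_coord[of 1]]
  have "pullback C \<Phi> x = \<sigma> x" if "x \<in> carrier L" for x
  proof (rule ring_homs_eqI[OF assms(1) pullback_ring_hom[OF dom] assms(2) _ _ that])
    show "pullback C \<Phi> (frac (\<lambda>v. c) (\<lambda>v. 1)) = \<sigma> (frac (\<lambda>v. c) (\<lambda>v. 1))" for c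
      using pb(1)[OF fractions_const] by (simp add: const comp_def)
    show "pullback C \<Phi> (frac (\<lambda>v. v $ 1) (\<lambda>v. v $ 2)) = \<sigma> (frac (\<lambda>v. v $ 1) (\<lambda>v. v $ 2))"
      unfolding \<sigma> pb(1)[OF XY]
      by (rule frac_eq[OF pb(2)[OF XY] fractions_over_Y_1[OF A]]) (use \<Phi>(2) in simp)
  qed
  then show ?thesis using \<Phi>(1) unfolding birational_of_def by blast
qed

end

section \<open>Extension to the plane\<close>

interpretation P2: irreducible_cone P2
  by (rule irreducible_P2)

lemma axis_point_P2: "vector [0, 1, 0] \<in> P2"
  unfolding proj_space_def by (simp add: vec_eq_iff forall_3 vector_3)

lemma shear_inverse: "shear a b (shear (- a) (- b) v) = (v $ 2) ^ 15 *s v"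
  by (simp add: shear_def vec_eq_iff forall_3 vector_3 algebra_simps power_numeral_reduce)

lemma birational_shear: "birational P2 (shear a b)"
proof (rule P2.birationalI[OF form_shear form_shear, of _ _ "- a" "- b" _ _ "vector [0, 1, 0]"])
  show "shear (- a) (- b) (shear a b v) = (v $ 2) ^ 15 *s v" for v
    using shear_inverse[of "- a" "- b"] by simp
  show "shear a b (shear (- a) (- b) v) = (v $ 2) ^ 15 *s v" for v
    by (rule shear_inverse)
qed (auto simp: axis_point_P2, auto simp: proj_space_def shear_def vec_eq_iff forall_3 vector_3)

lemma birational_linear:
  fixes M :: "complex ^ 3 ^ 3"
  assumes "invertible M"
  shows "birational P2 (\<lambda>v. M *v v)"
proof -
  obtain N where N: "M ** N = mat 1" "N ** M = mat 1" using assms unfolding invertible_def by blast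
  then have inv: "N *v (M *v v) = v" "M *v (N *v v) = v" for v
    by (simp_all add: matrix_vector_mul_assoc)
  have nz: "M *v v \<noteq> 0" "N *v v \<noteq> 0" if "v \<noteq> 0" for v
    using that inv[of v] by (metis matrix_vector_mult_0_right)+
  show ?thesis
    by (rule P2.birationalI[OF form_linear form_linear, of _ N "\<lambda>_. 1" "\<lambda>_. 1" "vector [0, 1, 0]"])
      (use nz axis_point_P2 inv in \<open>auto simp: proj_space_def\<close>)
qed

lemma invertible_affine_matrix: "c \<noteq> 0 \<Longrightarrow> invertible (affine_matrix c e)"
  by (simp add: invertible_det_nz det_3 affine_matrix_def vector_3)

lemma PGL3_subset_Bir: "PGL3 \<subseteq> carrier (Bir P2)"
  unfolding PGL3_def using birational_linear P2.bir_class_closed by blast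

text \<open>The affine map \<open>(x, z) \<mapsto> (c x + e, z)\<close> of the plane, transported by the shear.\<close>

definition sheared_affine :: "complex \<Rightarrow> complex \<Rightarrow> complex \<Rightarrow> complex \<Rightarrow> complex ^ 3 \<Rightarrow> complex ^ 3" where
  "sheared_affine a b c e = shear a b \<circ> (\<lambda>v. affine_matrix c e *v v) \<circ> shear (- a) (- b)"

lemma form_sheared_affine: "form 16 (\<lambda>v. sheared_affine a b c e v $ i)"
  using form_comp[OF form_comp[OF form_shear form_linear] form_shear, of a b i "affine_matrix c e" "- a" "- b"]
  by (simp add: sheared_affine_def comp_def)

lemma sheared_affine_inverse:
  assumes "c \<noteq> 0"
  shows "sheared_affine a b (1 / c) (- e / c) (sheared_affine a b c e v) = (v $ 2) ^ 255 *s v"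
proof -
  define w where "w = affine_matrix c e *v shear (- a) (- b) v"
  have w2: "w $ 2 = (v $ 2) ^ 4" by (simp add: w_def affine_matrix_mult shear_def vector_3)
  \<comment> \<open>Each cancelled pair of shears leaves a power of \<open>Y\<close>: altogether \<open>(Y^4)^60 * Y^15 = Y^255\<close>.\<close>
  have "sheared_affine a b (1 / c) (- e / c) (sheared_affine a b c e v)
      = shear a b (affine_matrix (1 / c) (- e / c) *v shear (- a) (- b) (shear a b w))"
    by (simp add: sheared_affine_def w_def)
  also have "\<dots> = shear a b (affine_matrix (1 / c) (- e / c) *v ((w $ 2) ^ 15 *s w))"
    using shear_inverse[of "- a" "- b"] by simp
  also have "affine_matrix (1 / c) (- e / c) *v ((w $ 2) ^ 15 *s w) = (w $ 2) ^ 15 *s shear (- a) (- b) v"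
    using assms by (simp add: w_def affine_matrix_mult vec_eq_iff forall_3 vector_3 field_simps)
  also have "shear a b \<dots> = (w $ 2) ^ 60 *s shear a b (shear (- a) (- b) v)"
    using form_homogeneous[OF form_shear] by (simp add: vec_eq_iff flip: power_mult)
  also have "\<dots> = (v $ 2) ^ 255 *s v"
    unfolding shear_inverse w2 by (simp add: vec_eq_iff flip: power_mult power_add)
  finally show ?thesis .
qed

lemma sheared_affine_inverse':
  assumes "c \<noteq> 0"
  shows "sheared_affine a b c e (sheared_affine a b (1 / c) (- e / c) v) = (v $ 2) ^ 255 *s v"
  using sheared_affine_inverse[of "1 / c" a b "- e / c"] assms by simp

lemma sheared_affine_1: "sheared_affine a b c e v $ 1 = (c * v $ 1 + e * v $ 2) * (v $ 2) ^ 15"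
  and sheared_affine_2: "sheared_affine a b c e v $ 2 = (v $ 2) ^ 16"
  by (simp_all add: sheared_affine_def affine_matrix_mult shear_def vector_3 algebra_simps flip: power_mult)
    (simp_all add: power_numeral_reduce algebra_simps)

lemma birational_sheared_affine: "c \<noteq> 0 \<Longrightarrow> birational P2 (sheared_affine a b c e)"
  unfolding sheared_affine_def
  by (intro P2.birational_comp birational_shear birational_linear invertible_affine_matrix)

text \<open>By construction: conjugating back with the shear leaves the affine map, which is linear.\<close>

lemma conjugate_to_linear_sheared_affine:
  assumes "c \<noteq> 0"
  shows "conjugate_to_linear (P2.bir_class (sheared_affine a b c e))"
proof -
  interpret Bir: group "Bir P2" by (rule P2.group_Bir)
  let ?S = "P2.bir_class (shear a b)" and ?T = "P2.bir_class (shear (- a) (- b))"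
    and ?A = "P2.bir_class (\<lambda>v. affine_matrix c e *v v)"
  note bir = birational_shear[of a b] birational_shear[of "- a" "- b"] birational_linear[OF invertible_affine_matrix[OF assms, of e]]
  note closed [simp] = bir[THEN P2.bir_class_closed]
  have one: "P2.bir_class id = \<one>\<^bsub>Bir P2\<^esub>" by (simp add: Bir_def)
  have "?T \<otimes>\<^bsub>Bir P2\<^esub> ?S = \<one>\<^bsub>Bir P2\<^esub>"
    unfolding P2.bir_class_mult[OF bir(2,1)] one[symmetric]
    by (rule P2.bir_class_eq[OF P2.birational_comp[OF bir(2,1)] P2.birational_id])
      (use shear_inverse[of "- a" "- b"] in \<open>simp add: same_map_def mult_ac\<close>)
  then have inv: "inv\<^bsub>Bir P2\<^esub> ?T = ?S"
    using Bir.inv_equality[of ?T ?S] Bir.inv_equality[of ?S ?T] Bir.inv_comm by simp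
  have "P2.bir_class (sheared_affine a b c e) = ?S \<otimes>\<^bsub>Bir P2\<^esub> ?A \<otimes>\<^bsub>Bir P2\<^esub> ?T"
    unfolding sheared_affine_def by (simp add: P2.bir_class_mult bir P2.birational_comp)
  then have "?T \<otimes>\<^bsub>Bir P2\<^esub> P2.bir_class (sheared_affine a b c e) \<otimes>\<^bsub>Bir P2\<^esub> inv\<^bsub>Bir P2\<^esub> ?T = ?A"
    using Bir.m_assoc Bir.r_inv[of ?T] Bir.l_inv[of ?T] inv by (metis Bir.inv_solve_left' Bir.inv_solve_right' Bir.m_closed closed)
  then show ?thesis
    unfolding conjugate_to_linear_def PGL3_def
    using closed(2) invertible_affine_matrix[OF assms] by blast
qed

context graph_quartic_curve
begin

text \<open>
  The inner shear carries the curve to the line \<open>z = 0\<close>, the affine map keeps that line, and the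
  outer shear returns to the curve.
\<close>

lemma sheared_affine_preserves_C:
  assumes "v \<in> C" "sheared_affine a b c e v \<noteq> 0"
  shows "sheared_affine a b c e v \<in> C"
proof -
  define x y where "x = c * (v $ 1 * (v $ 2) ^ 3) + e * (v $ 2) ^ 4" and "y = (v $ 2) ^ 4"
  have "sheared_affine a b c e v = vector [x * y ^ 3, y ^ 4, a * x ^ 4 + b * x ^ 3 * y]"
    using on_C[OF assms(1)]
    by (simp add: sheared_affine_def shear_def affine_matrix_mult vec_eq_iff forall_3 vector_3 x_def y_def algebra_simps)
  moreover have "graph_quartic a b (vector [x * y ^ 3, y ^ 4, a * x ^ 4 + b * x ^ 3 * y]) = 0"
    by (simp add: graph_quartic_def vector_3 algebra_simps power_numeral_reduce)
  ultimately show ?thesis using assms(2) unfolding curve_def proj_space_def by simp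
qed

lemma sheared_affine_nonzero_at_flex: "sheared_affine a b c e (vector [0, 1, 0]) \<noteq> 0"
  using sheared_affine_2[of a b c e "vector [0, 1, 0]"] by (metis power_one vector_3(2) zero_index zero_neq_one)

lemma birational_C_sheared_affine:
  assumes "c \<noteq> 0"
  shows "birational C (sheared_affine a b c e)"
  by (rule birationalI[OF form_sheared_affine form_sheared_affine, where w = "vector [0, 1, 0]" and g = "\<lambda>v. (v $ 2) ^ 255" and h = "\<lambda>v. (v $ 2) ^ 255"])
    (auto simp: sheared_affine_preserves_C flex_on_C sheared_affine_nonzero_at_flex vector_3
      intro!: sheared_affine_inverse[OF assms] sheared_affine_inverse'[OF assms])

text \<open>
  The automorphism \<open>u \<mapsto> c u + (1 - c) e\<close> is an affine map of the line \<open>z = 0\<close> and as such the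
  restriction of an affine map of the plane.
\<close>

lemma galois_extends:
  fixes M :: "complex ^ 3 ^ 2"
  assumes "galois_point C P" "\<sigma> \<in> carrier (G_at C P)"
    "{v. M *v v = 0} = range (\<lambda>c. c *s P)"
    "form d A" "form d B" "\<exists>v\<in>C. B (M *v v) \<noteq> 0"
    "\<And>v. v \<in> C \<Longrightarrow> A (M *v v) * (v $ 2) ^ 3 = (v $ 1 - e * v $ 2) ^ 3 * B (M *v v)"
  shows "\<exists>\<tau>\<in>carrier (Bir P2). restricts_to \<tau> C (birational_of C \<sigma>) \<and> conjugate_to_linear \<tau>"
proof -
  obtain c where c: "c ^ 3 = 1" and \<sigma>: "field L" "\<sigma> \<in> ring_hom L L"
    "\<And>k. \<sigma> (frac (\<lambda>v. k) (\<lambda>v. 1)) = frac (\<lambda>v. k) (\<lambda>v. 1)"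
    "\<sigma> (frac (\<lambda>v. v $ 1) (\<lambda>v. v $ 2)) = frac (\<lambda>v. c * v $ 1 + (1 - c) * e * v $ 2) (\<lambda>v. v $ 2)"
    using galois_image[OF assms] by blast
  have c0: "c \<noteq> 0" using c by auto
  define \<Phi> where "\<Phi> = sheared_affine a b c ((1 - c) * e)"
  have "\<Phi> \<in> birational_of C \<sigma>"
  proof (rule mem_birational_ofI[OF \<sigma>])
    show "form 1 (\<lambda>v :: complex ^ 3. c * v $ 1 + (1 - c) * e * v $ 2)"
      by (intro form_add form_scale form_coord)
    show "birational C \<Phi>" unfolding \<Phi>_def by (rule birational_C_sheared_affine[OF c0])
    show "\<Phi> v $ 1 * v $ 2 = (c * v $ 1 + (1 - c) * e * v $ 2) * \<Phi> v $ 2" for v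
      unfolding \<Phi>_def sheared_affine_1 sheared_affine_2 by (simp add: power_numeral_reduce)
  qed
  moreover have "birational P2 \<Phi>" unfolding \<Phi>_def by (rule birational_sheared_affine[OF c0])
  moreover have "\<exists>v\<in>C. \<Phi> v \<noteq> 0" unfolding \<Phi>_def using flex_on_C sheared_affine_nonzero_at_flex by blast
  ultimately have "restricts_to (P2.bir_class \<Phi>) C (birational_of C \<sigma>)"
    unfolding restricts_to_def using P2.bir_class_self by blast
  then show ?thesis
    using P2.bir_class_closed[OF \<open>birational P2 \<Phi>\<close>] conjugate_to_linear_sheared_affine[OF c0]
    unfolding \<Phi>_def by blast
qed

text \<open>
  Without the cubic term the curve is invariant under \<open>(X : Y : Z) \<mapsto> (c X : Y : c Z)\<close>, since
  \<open>c\<^sup>4 = c\<close>; and this map already induces \<open>u \<mapsto> c u\<close>.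
\<close>

lemma galois_linear:
  fixes M :: "complex ^ 3 ^ 2"
  assumes b: "b = 0"
  assumes "galois_point C P" "\<sigma> \<in> carrier (G_at C P)"
    "{v. M *v v = 0} = range (\<lambda>c. c *s P)"
    "form d A" "form d B" "\<exists>v\<in>C. B (M *v v) \<noteq> 0"
    "\<And>v. v \<in> C \<Longrightarrow> A (M *v v) * (v $ 2) ^ 3 = (v $ 1) ^ 3 * B (M *v v)"
  shows "\<exists>\<tau>\<in>PGL3. restricts_to \<tau> C (birational_of C \<sigma>)"
proof -
  have cube: "A (M *v v) * (v $ 2) ^ 3 = (v $ 1 - 0 * v $ 2) ^ 3 * B (M *v v)" if "v \<in> C" for v
    using assms(8) that by simp
  obtain c where c: "c ^ 3 = 1" and \<sigma>: "field L" "\<sigma> \<in> ring_hom L L"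
    "\<And>k. \<sigma> (frac (\<lambda>v. k) (\<lambda>v. 1)) = frac (\<lambda>v. k) (\<lambda>v. 1)"
    "\<sigma> (frac (\<lambda>v. v $ 1) (\<lambda>v. v $ 2)) = frac (\<lambda>v. c * v $ 1 + (1 - c) * 0 * v $ 2) (\<lambda>v. v $ 2)"
    using galois_image[OF assms(2-7) cube] by blast
  have c0: "c \<noteq> 0" using c by auto
  define N :: "complex \<Rightarrow> complex ^ 3 ^ 3"
    where "N c = vector [vector [c, 0, 0], vector [0, 1, 0], vector [0, 0, c]]" for c
  have N: "N c *v v = vector [c * v $ 1, v $ 2, c * v $ 3]" for c v
    by (simp add: N_def vec_eq_iff forall_3 matrix_vector_mult_def sum_3 vector_3)
  have "invertible (N c)" using c0 by (simp add: invertible_det_nz det_3 N_def vector_3)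
  have N_C: "N c *v v \<in> C" if "v \<in> C" "N c *v v \<noteq> 0" "c ^ 3 = 1" for c v
  proof -
    have "graph_quartic a b (N c *v v) = c * graph_quartic a b v"
      using arg_cong[OF that(3), of "\<lambda>x. a * c * x * v $ 1 ^ 4"]
      by (simp add: N graph_quartic_def vector_3 b algebra_simps power_mult_distrib power_numeral_reduce)
    then show ?thesis using that unfolding curve_def proj_space_def by simp
  qed
  have N_inv: "N (1 / c) *v (N c *v v) = 1 *s v" "N c *v (N (1 / c) *v v) = 1 *s v" for v
    using c0 by (simp_all add: N vec_eq_iff forall_3 vector_3)
  have N_flex: "N c *v vector [0, 1, 0] \<noteq> 0" for c
    by (simp add: N vec_eq_iff forall_3 vector_3)
  have "(\<lambda>v. N c *v v) \<in> birational_of C \<sigma>"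
  proof (rule mem_birational_ofI[OF \<sigma>])
    show "form 1 (\<lambda>v :: complex ^ 3. c * v $ 1 + (1 - c) * 0 * v $ 2)"
      by (intro form_add form_scale form_coord)
    show "birational C (\<lambda>v. N c *v v)"
      by (rule birationalI[OF form_linear form_linear, of _ "N (1 / c)" "\<lambda>_. 1" "\<lambda>_. 1" "vector [0, 1, 0]"])
        (use c N_C N_inv flex_on_C N_flex in \<open>auto simp: power_divide\<close>)
    show "(N c *v v) $ 1 * v $ 2 = (c * v $ 1 + (1 - c) * 0 * v $ 2) * (N c *v v) $ 2" for v
      by (simp add: N vector_3)
  qed
  moreover have "(\<lambda>v. N c *v v) \<in> P2.bir_class (\<lambda>v. N c *v v)"
    by (rule P2.bir_class_self[OF birational_linear[OF \<open>invertible (N c)\<close>]])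
  ultimately have "restricts_to (P2.bir_class (\<lambda>v. N c *v v)) C (birational_of C \<sigma>)"
    unfolding restricts_to_def using flex_on_C N_flex by blast
  then show ?thesis unfolding PGL3_def using \<open>invertible (N c)\<close> by blast
qed

end

section \<open>The two quartics\<close>

lemma C_a_graph: "C_a = curve (graph_quartic (- 1) 1)"
  unfolding curve_def F_a_def graph_quartic_def by (auto simp: algebra_simps)

lemma C_b_graph: "C_b = curve (graph_quartic 1 0)"
  unfolding curve_def F_b_def graph_quartic_def by (auto simp: algebra_simps)

interpretation Ca: graph_quartic_curve "- 1" 1
  by unfold_locales simp

interpretation Cb: graph_quartic_curve 1 0
  by unfold_locales simp

lemma matrix_2_3_mult:
  "(vector [vector [p, q, r], vector [p', q', r']] :: complex ^ 3 ^ 2) *v v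
    = vector [p * v $ 1 + q * v $ 2 + r * v $ 3, p' * v $ 1 + q' * v $ 2 + r' * v $ 3]"
  by (simp add: vec_eq_iff forall_2 matrix_vector_mult_def sum_3 vector_2 vector_3)

lemma vector_2_eq_0: "vector [x, y] = (0 :: complex ^ 2) \<longleftrightarrow> x = 0 \<and> y = 0"
  by (simp add: vec_eq_iff forall_2 vector_2)

lemma kernel_eqI:
  fixes M :: "complex ^ 3 ^ 2"
  assumes "M *v P = 0" and "\<And>v. M *v v = 0 \<Longrightarrow> v = f v *s P"
  shows "{v. M *v v = 0} = range (\<lambda>c. c *s P)"
  using assms by (auto simp: matrix_vector_mult_scaleR vector_scalar_commute image_iff)

theorem theorem2:
  fixes p1 p2 p3 :: "complex ^ 3"
    and \<sigma>1 \<sigma>2 \<sigma>3 :: "3 ratfun \<Rightarrow> 3 ratfun"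
  assumes "p1 = vector [1, 1, 0]" and "p2 = vector [8, -16, 3]" and "p3 = vector [0, 1, 0]"
    and "smooth_galois_point F_a p1" and "smooth_galois_point F_a p2"
    and "smooth_galois_point F_b p3"
    and "generator (G_at C_a p1) \<sigma>1" and "generator (G_at C_a p2) \<sigma>2"
    and "generator (G_at C_b p3) \<sigma>3"
  shows "(\<exists>\<tau>\<in>carrier (Bir P2). restricts_to \<tau> C_a (birational_of C_a \<sigma>1)) \<and>
         (\<exists>\<tau>\<in>carrier (Bir P2). restricts_to \<tau> C_a (birational_of C_a \<sigma>2)) \<and>
         (\<exists>\<tau>\<in>carrier (Bir P2). restricts_to \<tau> C_b (birational_of C_b \<sigma>3)) \<and>
         (\<exists>\<tau>\<in>carrier (Bir P2). restricts_to \<tau> C_a (birational_of C_a \<sigma>1) \<and>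
            conjugate_to_linear \<tau>) \<and>
         (\<exists>\<tau>\<in>carrier (Bir P2). restricts_to \<tau> C_a (birational_of C_a \<sigma>2) \<and>
            conjugate_to_linear \<tau>) \<and>
         (\<exists>\<tau>\<in>PGL3. restricts_to \<tau> C_b (birational_of C_b \<sigma>3))"
proof -
  have gal: "galois_point C_a p1" "galois_point C_a p2" "galois_point C_b p3"
    using assms(4-6) unfolding smooth_galois_point_def by blast+
  have \<sigma>: "\<sigma>1 \<in> carrier (G_at C_a p1)" "\<sigma>2 \<in> carrier (G_at C_a p2)" "\<sigma>3 \<in> carrier (G_at C_b p3)"
    using assms(7-9) unfolding generator_def by blast+
  note 1 = gal(1) \<sigma>(1) and 2 = gal(2) \<sigma>(2) and 3 = gal(3) \<sigma>(3)
  have form_quarter: "form 1 (\<lambda>w :: complex ^ 2. 1 / 4 * w $ 1 - w $ 2)"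
    by (intro form_diff form_scale form_coord)
  \<comment> \<open>The point \<open>p1\<close> has parameter \<open>u = 1\<close>; on the curve \<open>Z = - u\<^sup>3 (X - Y)\<close>, so the projection is \<open>u \<mapsto> u\<^sup>3\<close> up to sign.\<close>
  let ?M1 = "vector [vector [1, - 1, 0], vector [0, 0, 1]] :: complex ^ 3 ^ 2"
  have "{v. ?M1 *v v = 0} = range (\<lambda>c. c *s p1)"
    by (rule kernel_eqI[of _ _ "\<lambda>v. v $ 1"])
      (simp_all add: assms(1) matrix_2_3_mult vector_2_eq_0 vector_3, auto simp: vec_eq_iff forall_3 vector_3)
  note ext1 = Ca.galois_extends[folded C_a_graph, OF 1 this form_uminus[OF form_coord[of 2]] form_coord[of 1], of 0]
  have ext1: "\<exists>\<tau>\<in>carrier (Bir P2). restricts_to \<tau> C_a (birational_of C_a \<sigma>1) \<and> conjugate_to_linear \<tau>"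
  proof (rule ext1)
    show "\<exists>v\<in>C_a. (?M1 *v v) $ 1 \<noteq> 0"
      using Ca.flex_on_C by (auto simp: C_a_graph matrix_2_3_mult vector_2 vector_3 intro!: bexI[of _ "vector [0, 1, 0]"])
    show "- (?M1 *v v) $ 2 * (v $ 2) ^ 3 = (v $ 1 - 0 * v $ 2) ^ 3 * (?M1 *v v) $ 1" if "v \<in> C_a" for v
      using Ca.on_C[of v] that
      by (simp add: C_a_graph matrix_2_3_mult vector_2 algebra_simps power_numeral_reduce)
  qed
  (* The point p2 has parameter u = -1/2, and u^4 - u^3 - 3/16 = (u + 1/2) ((u - 1/2)^3 - 1/4):
     hence e = 1/2, and the constant 1/4 has to be compensated by the form on the line. *)
  let ?M2 = "vector [vector [1, 1 / 2, 0], vector [0, 3 / 16, 1]] :: complex ^ 3 ^ 2"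
  have "{v. ?M2 *v v = 0} = range (\<lambda>c. c *s p2)"
  proof (rule kernel_eqI[of _ _ "\<lambda>v. - v $ 2 / 16"])
    show "?M2 *v p2 = 0"
      by (simp add: assms(2) matrix_2_3_mult vector_2_eq_0 vector_3)
    fix v assume "?M2 *v v = 0"
    then have "v $ 1 = - (1 / 2 * v $ 2)" "v $ 3 = - (3 / 16 * v $ 2)"
      by (simp_all add: matrix_2_3_mult vector_2_eq_0 eq_neg_iff_add_eq_0 add.commute)
    then show "v = (- v $ 2 / 16) *s p2"
      by (simp add: assms(2) vec_eq_iff forall_3 vector_3)
  qed
  note ext2 = Ca.galois_extends[folded C_a_graph, OF 2 this form_quarter form_coord[of 1], of "1 / 2"]
  have ext2: "\<exists>\<tau>\<in>carrier (Bir P2). restricts_to \<tau> C_a (birational_of C_a \<sigma>2) \<and> conjugate_to_linear \<tau>"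
  proof (rule ext2)
    show "\<exists>v\<in>C_a. (?M2 *v v) $ 1 \<noteq> 0"
      using Ca.flex_on_C by (auto simp: C_a_graph matrix_2_3_mult vector_2 vector_3 intro!: bexI[of _ "vector [0, 1, 0]"])
    show "(1 / 4 * (?M2 *v v) $ 1 - (?M2 *v v) $ 2) * (v $ 2) ^ 3
        = (v $ 1 - 1 / 2 * v $ 2) ^ 3 * (?M2 *v v) $ 1" if "v \<in> C_a" for v
    proof -
      have "(1 / 4 * (?M2 *v v) $ 1 - (?M2 *v v) $ 2) * (v $ 2) ^ 3
          - (v $ 1 - 1 / 2 * v $ 2) ^ 3 * (?M2 *v v) $ 1
          = (- 1 * (v $ 1) ^ 4 + 1 * (v $ 1) ^ 3 * v $ 2) - (v $ 2) ^ 3 * v $ 3"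
        by (simp add: matrix_2_3_mult vector_2 field_simps power_numeral_reduce)
      then show ?thesis using Ca.on_C[of v] that by (simp add: C_a_graph)
    qed
  qed
  \<comment> \<open>On the second curve \<open>Z/X = u\<^sup>3\<close>.\<close>
  let ?M3 = "vector [vector [1, 0, 0], vector [0, 0, 1]] :: complex ^ 3 ^ 2"
  have ker3: "{v. ?M3 *v v = 0} = range (\<lambda>c. c *s p3)"
    by (rule kernel_eqI[of _ _ "\<lambda>v. v $ 2"])
      (simp_all add: assms(3) matrix_2_3_mult vector_2_eq_0 vector_3, auto simp: vec_eq_iff forall_3 vector_3)
  have nonzero3: "\<exists>v\<in>C_b. (?M3 *v v) $ 1 \<noteq> 0"
    by (rule bexI[of _ "vector [1, 1, 1]"])
      (auto simp: curve_def proj_space_def F_b_def matrix_2_3_mult vector_2 vector_3 vec_eq_iff forall_3)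
  have cube3: "(?M3 *v v) $ 2 * (v $ 2) ^ 3 = (v $ 1) ^ 3 * (?M3 *v v) $ 1" if "v \<in> C_b" for v
    using Cb.on_C[of v] that
    by (simp add: C_b_graph matrix_2_3_mult vector_2 algebra_simps power_numeral_reduce)
  have "\<exists>\<tau>\<in>PGL3. restricts_to \<tau> C_b (birational_of C_b \<sigma>3)"
    using Cb.galois_linear[folded C_b_graph, OF refl 3 ker3 form_coord[of 2] form_coord[of 1] nonzero3 cube3] .
  then show ?thesis using ext1 ext2 PGL3_subset_Bir by blast
qed

end
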